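(* Let $\lambda_L = M(L)\approx 1.17628$ be the Mahler measure of $L(t)=t^{10}+t^9-t^7-t^6-t^5-t^4-t^3+t+1$. For each integer $i\ge 1$, let $R_i$ be the smallest Mahler measure larger than $1$ among monic integer reciprocal polynomials of degree $2^i$, and let $S_i$ be the smallest Mahler measure larger than $1$ among monic integer skew-reciprocal polynomials of degree $2^i$. Then: (1) $\lambda_L$ is the smallest Mahler measure larger than $1$ among all monic integer polynomials if and only if $R_i=S_i$ for all $i\ge 5$. (2) The set of Mahler measures of monic integer polynomials accumulates at $1$ if and only if $\prod_{i=5}^{N}\frac{R_i}{S_i}$ converges to $\lambda_L^{-1}$ as $N\to\infty$.
   Context: For a monic polynomial $f\in\mathbf{Z}[t]$, its Mahler measure is $M(f)=\prod_{f(\alpha)=0}\max(1,|\alpha|)$, the product over all complex zeroes counted with multiplicity. A polynomial $f\in\mathbf{Z}[t]$ of degree $d$ is reciprocal if $f(t)=t^d f(t^{-1})$. A polynomial $f\in\mathbf{Z}[t]$ of even degree $2d$ is skew-reciprocal if $f(t)=(-1)^d t^{2d} f(-t^{-1})$. *)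

theory Defs
  imports
    "HOL-Analysis.Analysis"
    "Berlekamp_Zassenhaus.Mahler_Measure"
begin

text \<open>\<open>reflect_poly f\<close> is the polynomial \<open>t ^ degree f * f(1/t)\<close>, also when \<open>f(0) = 0\<close>.\<close>

definition reciprocal_poly :: "int poly \<Rightarrow> bool" where
  "reciprocal_poly f \<longleftrightarrow> f = reflect_poly f"

text \<open>
  \<open>pcompose f [:0, -1:]\<close> is \<open>f(-t)\<close>, so its reflection is \<open>t ^ degree f * f(-1/t)\<close>.
\<close>

definition skew_reciprocal_poly :: "int poly \<Rightarrow> bool" where
  "skew_reciprocal_poly f \<longleftrightarrow> even (degree f) \<and>
     f = Polynomial.smult ((-1) ^ (degree f div 2)) (reflect_poly (pcompose f [:0, -1:]))"

lemma poly_eqI_nz: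
  fixes p q :: "complex poly"
  assumes "\<And>t. t \<noteq> 0 \<Longrightarrow> poly p t = poly q t"
  shows "p = q"
proof -
  have "\<not> finite (UNIV - {0::complex})" using infinite_UNIV_char_0 by simp
  moreover have "UNIV - {0} \<subseteq> {t. poly (p - q) t = 0}" using assms by auto
  ultimately have "p - q = 0" using poly_roots_finite[of "p-q"] finite_subset by blast
  thus ?thesis by simp
qed

lemma reciprocal_poly_functional_equation:
  "reciprocal_poly f \<longleftrightarrow>
     (\<forall>t::complex. t \<noteq> 0 \<longrightarrow>
        poly (of_int_poly f) t = t ^ degree f * poly (of_int_poly f) (1 / t))"
proof -
  let ?F = "of_int_poly f :: complex poly"
  have d: "degree ?F = degree f" by simp
  have r: "of_int_poly (reflect_poly f) = reflect_poly ?F"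
    by (intro poly_eqI) (simp add: coeff_reflect_poly)
  have "reciprocal_poly f \<longleftrightarrow> ?F = reflect_poly ?F"
    unfolding reciprocal_poly_def by (metis r of_int_poly_hom.eq_iff)
  also have "\<dots> \<longleftrightarrow> (\<forall>t. t \<noteq> 0 \<longrightarrow> poly ?F t = poly (reflect_poly ?F) t)"
    using poly_eqI_nz by metis
  finally show ?thesis by (simp add: poly_reflect_poly_nz d inverse_eq_divide)
qed

lemma skew_reciprocal_poly_functional_equation:
  assumes "degree f = 2 * d"
  shows "skew_reciprocal_poly f \<longleftrightarrow>
     (\<forall>t::complex. t \<noteq> 0 \<longrightarrow>
        poly (of_int_poly f) t = (-1) ^ d * t ^ (2 * d) * poly (of_int_poly f) (- (1 / t)))"
proof -
  let ?F = "of_int_poly f :: complex poly"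
  let ?G = "pcompose f [:0, -1:]"
  have g: "of_int_poly ?G = pcompose ?F [:0, -1:]"
    by (simp add: of_int_hom.map_poly_pcompose)
  have d: "degree (of_int_poly ?G :: complex poly) = 2 * d"
    using assms by (simp add: degree_pcompose)
  have r: "of_int_poly (Polynomial.smult ((-1) ^ d) (reflect_poly ?G)) =
      Polynomial.smult ((-1) ^ d) (reflect_poly (of_int_poly ?G :: complex poly))" (is "_ = ?H")
    by (intro poly_eqI) (simp add: coeff_reflect_poly)
  have H: "poly ?H t = (-1) ^ d * t ^ (2 * d) * poly ?F (- (1 / t))" if "t \<noteq> 0" for t
    using that assms
    by (simp add: poly_reflect_poly_nz d) (simp add: g poly_pcompose inverse_eq_divide)
  have "skew_reciprocal_poly f \<longleftrightarrow> ?F = ?H"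
    unfolding skew_reciprocal_poly_def using assms
    by (simp flip: r)
  also have "\<dots> \<longleftrightarrow> (\<forall>t. t \<noteq> 0 \<longrightarrow> poly ?F t = poly ?H t)"
    using poly_eqI_nz by metis
  finally show ?thesis using H by metis
qed

text \<open>
  The library's \<open>mahler_measure\<close> carries an extra factor \<open>\<bar>lead_coeff f\<bar>\<close>, which is 1 for the
  monic polynomials considered here.
\<close>

lemma mahler_measure_monic_eq:
  assumes "monic f"
  shows "mahler_measure f = (\<Prod>\<alpha>\<leftarrow>complex_roots_int f. max 1 (cmod \<alpha>))"
  using assms
  by (simp add: mahler_measure_def mahler_measure_poly_def complex_roots_int_def)

definition is_smallest :: "real \<Rightarrow> real set \<Rightarrow> bool" where
  "is_smallest x A \<longleftrightarrow> x \<in> A \<and> (\<forall>y\<in>A. x \<le> y)"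

definition lehmer_poly :: "int poly" where
  "lehmer_poly = [:1, 1, 0, -1, -1, -1, -1, -1, 0, 1, 1:]"

lemma poly_lehmer_poly:
  "poly lehmer_poly t = t^10 + t^9 - t^7 - t^6 - t^5 - t^4 - t^3 + t + 1"
  by (simp add: lehmer_poly_def algebra_simps eval_nat_numeral)

definition lehmer_number :: real where
  "lehmer_number = mahler_measure lehmer_poly"

definition smallest_reciprocal_measure :: "nat \<Rightarrow> real" where
  "smallest_reciprocal_measure i = (THE x. is_smallest x
     {mahler_measure f |f. monic f \<and> reciprocal_poly f \<and> degree f = 2 ^ i \<and> mahler_measure f > 1})"

definition smallest_skew_reciprocal_measure :: "nat \<Rightarrow> real" where
  "smallest_skew_reciprocal_measure i = (THE x. is_smallest x
     {mahler_measure f |f. monic f \<and> skew_reciprocal_poly f \<and> degree f = 2 ^ i \<and> mahler_measure f > 1})"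

end

theory Submission
  imports Defs "Berlekamp_Zassenhaus.Factor_Bound"
begin

text \<open>
  Write \<open>R\<^sub>i\<close> and \<open>S\<^sub>i\<close> for the two minima. A skew-reciprocal polynomial \<open>f\<close> of degree \<open>2\<^sup>i\<close> that is
  also reciprocal up to sign satisfies \<open>f(t) = f(-t)\<close>, hence \<open>f(t) = g(t\<^sup>2)\<close> with \<open>g\<close> reciprocal of
  degree \<open>2\<^sup>i\<^sup>-\<^sup>1\<close>, and polynomials that are not reciprocal up to sign have Mahler measure at least
  \<open>c = (1 + \<surd>17) / 4 > \<lambda>\<^sub>L\<close> (a weak form of Smyth's theorem). So \<open>S\<^sub>i = R\<^sub>i\<^sub>-\<^sub>1\<close>, the product telescopes
  to \<open>R\<^sub>N / R\<^sub>4\<close>, and every Mahler measure in \<open>(1, c)\<close> is attained by a reciprocal polynomial of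
  degree \<open>2\<^sup>i\<close> for all large \<open>i\<close>.

  What remains is \<open>R\<^sub>4 = \<lambda>\<^sub>L\<close>. A counterexample \<open>q\<close> of minimal degree \<open>2d \<le> 16\<close> is reciprocal and no
  zero of it is a root of unity, so the nonzero integers \<open>\<Prod>(1 \<mp> \<alpha>\<^sup>k)\<close> and \<open>\<Prod>(\<alpha>\<^sup>2\<^sup>k \<mp> \<alpha>\<^sup>k + 1)\<close> have
  absolute value at least 1. Through an auxiliary function this bounds every power sum of \<open>q\<close>, and
  Newton's identities leave a search tree small enough to be evaluated in the logic; its leaves are
  refuted by further power sums, by exact division and by Graeffe iteration.
\<close>

no_notation vec_index (infixl "$" 100)
unbundle no vec_syntax
unbundle fps_syntax
hide_const (open) up_ring.coeff up_ring.monom Module.smult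

section \<open>Zeros and Mahler measure\<close>

lemma of_int_poly_eq_prod_roots:
  assumes "monic f"
  shows "of_int_poly f = (\<Prod>\<alpha>\<leftarrow>complex_roots_int f. [:- \<alpha>, 1:])"
  using complex_roots_int(1)[of f] assms by simp

lemma poly_prod_linear_eq_0_iff:
  fixes x :: "'a :: idom"
  shows "poly (\<Prod>\<alpha>\<leftarrow>as. [:- \<alpha>, 1:]) x = 0 \<longleftrightarrow> x \<in> set as"
  by (induction as) auto

lemma set_complex_roots_int:
  assumes "f \<noteq> 0"
  shows "set (complex_roots_int f) = {\<alpha>. poly (of_int_poly f) \<alpha> = 0}"
proof -
  have "poly (of_int_poly f) \<alpha> = of_int (lead_coeff f) * poly (\<Prod>\<alpha>\<leftarrow>complex_roots_int f. [:- \<alpha>, 1:]) \<alpha>" for \<alpha>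
    by (subst complex_roots_int(1)[symmetric]) simp
  then show ?thesis
    using assms
    by (auto simp only: mult_eq_0_iff of_int_eq_0_iff leading_coeff_0_iff poly_prod_linear_eq_0_iff)
qed

lemma mahler_measure_mult: "mahler_measure (f * g) = mahler_measure f * mahler_measure g"
  by (simp add: mahler_measure_def of_int_poly_hom.hom_mult measure_eq_prod)

lemma mahler_measure_const [simp]: "mahler_measure [:c:] = \<bar>c\<bar>"
  using mahler_measure_constant[of "of_int c"]
  by (simp add: mahler_measure_def of_int_hom.map_poly_pCons_hom)

lemma mahler_measure_1 [simp]: "mahler_measure 1 = 1"
  using mahler_measure_const[of 1] by simp

lemma mahler_measure_power: "mahler_measure (f ^ n) = mahler_measure f ^ n"
  by (induction n) (simp_all add: mahler_measure_mult)

lemma mahler_measure_uminus: "mahler_measure (- f) = mahler_measure f"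
  using mahler_measure_mult[of "[:-1:]" f] by simp

lemma mahler_measure_linear: "mahler_measure [:a, 1:] = max 1 \<bar>real_of_int a\<bar>"
  using mahler_measure_factor[of "- of_int a"] by (simp add: mahler_measure_def)

lemma mahler_measure_poly_pcompose:
  assumes "\<And>\<alpha>. mahler_measure_poly (g - [:\<alpha>:]) = max 1 (cmod \<alpha>)"
  shows "mahler_measure_poly (f \<circ>\<^sub>p g) = mahler_measure_poly f"
proof -
  have "mahler_measure_poly ((\<Prod>\<alpha>\<leftarrow>as. [:- \<alpha>, 1:]) \<circ>\<^sub>p g) = (\<Prod>\<alpha>\<leftarrow>as. max 1 (cmod \<alpha>))" for as
  proof (induction as)
    case (Cons \<alpha> as)
    have "[:- \<alpha>, 1:] \<circ>\<^sub>p g = g - [:\<alpha>:]" by (simp add: pcompose_pCons)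
    with Cons assms show ?case
      by (simp only: list.map prod_list.Cons pcompose_mult measure_eq_prod)
  qed (use mahler_measure_constant[of 1] in simp)
  then have "mahler_measure_poly (Polynomial.smult c (\<Prod>\<alpha>\<leftarrow>as. [:- \<alpha>, 1:]) \<circ>\<^sub>p g) = cmod c * (\<Prod>\<alpha>\<leftarrow>as. max 1 (cmod \<alpha>))" for c as
    using measure_eq_prod[of "[:c:]"] by (simp add: pcompose_smult)
  from this[of "lead_coeff f" "complex_roots_complex f"] show ?thesis
    unfolding complex_roots(1) by (simp only: mahler_measure_poly_def)
qed

lemma mahler_measure_pcompose_neg: "mahler_measure (f \<circ>\<^sub>p [:0, -1:]) = mahler_measure f"
proof -
  have "mahler_measure_poly ([:0, -1:] - [:\<alpha>:]) = max 1 (cmod \<alpha>)" for \<alpha>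
    using mahler_measure_poly_explicit[of "-1" "[- \<alpha>]"] by simp
  from mahler_measure_poly_pcompose[OF this] show ?thesis
    by (simp add: mahler_measure_def of_int_hom.map_poly_pcompose)
qed

lemma max_1_power:
  fixes x :: "'a :: linordered_semidom"
  assumes "x \<ge> 0"
  shows "max 1 (x ^ n) = max 1 x ^ n"
  using assms power_le_one[of x n] one_le_power[of x n] by (cases "x \<le> 1") (auto simp: max_def)

lemma mahler_measure_poly_monom_minus_const:
  assumes "n \<ge> 1"
  shows "mahler_measure_poly (monom 1 n - [:\<alpha>:]) = max 1 (cmod \<alpha>)"
proof -
  define p where "p = monom 1 n + [:- \<alpha>:]"
  have deg: "degree p = n"
    using assms degree_add_eq_left[of "[:- \<alpha>:]" "monom 1 n"] by (simp add: p_def degree_monom_eq)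
  have monic: "lead_coeff p = 1"
    using assms unfolding deg by (simp add: p_def coeff_pCons split: nat.splits)
  have "\<beta> ^ n = \<alpha>" if "\<beta> \<in> set (complex_roots_complex p)" for \<beta>
  proof -
    have "poly p \<beta> = 0"
      using that
      by (subst complex_roots(1)[symmetric])
        (simp only: poly_smult mult_eq_0_iff poly_prod_linear_eq_0_iff simp_thms)
    then show ?thesis by (simp add: p_def poly_monom)
  qed
  then have root: "max 1 (cmod \<beta>) ^ n = max 1 (cmod \<alpha>)" if "\<beta> \<in> set (complex_roots_complex p)" for \<beta>
    using that by (metis max_1_power norm_ge_zero norm_power)
  have "mahler_measure_poly p ^ n = (\<Prod>\<beta>\<leftarrow>complex_roots_complex p. max 1 (cmod \<beta>) ^ n)"
    by (simp add: mahler_measure_poly_def monic prod_list_power o_def)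
  also have "\<dots> = (\<Prod>\<beta>\<leftarrow>complex_roots_complex p. max 1 (cmod \<alpha>))"
    using root by (intro arg_cong[of _ _ prod_list] map_cong) auto
  also have "\<dots> = max 1 (cmod \<alpha>) ^ n"
    by (simp add: complex_roots(2) deg map_replicate_const)
  finally have "mahler_measure_poly p = max 1 (cmod \<alpha>)"
    using assms
    by (subst (asm) power_eq_iff_eq_base)
      (auto simp: mahler_measure_poly_via_monic mahler_measure_monic_ge_0)
  then show ?thesis by (simp only: p_def diff_conv_add_uminus minus_pCons minus_zero)
qed

lemma mahler_measure_pcompose_monom:
  assumes "n \<ge> 1"
  shows "mahler_measure (f \<circ>\<^sub>p monom 1 n) = mahler_measure f"
  using mahler_measure_poly_pcompose[OF mahler_measure_poly_monom_minus_const[OF assms]]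
  by (simp add: mahler_measure_def of_int_hom.map_poly_pcompose of_int_hom.map_poly_hom_monom)

lemma mahler_measure_eq_1I:
  assumes "monic f" "\<And>\<alpha>. poly (of_int_poly f) \<alpha> = 0 \<Longrightarrow> cmod \<alpha> \<le> 1"
  shows "mahler_measure f = 1"
proof -
  have "(\<Prod>\<alpha>\<leftarrow>as. max 1 (cmod \<alpha>)) = 1" if "\<forall>\<alpha>\<in>set as. cmod \<alpha> \<le> 1" for as
    using that by (induction as) auto
  moreover have "f \<noteq> 0" using assms(1) by auto
  ultimately show ?thesis
    using assms by (simp add: mahler_measure_monic_eq set_complex_roots_int)
qed

lemma finite_mahler_measure_le: "finite {f :: int poly. degree f \<le> n \<and> mahler_measure f \<le> C}"
proof -
  define K where "K = \<lceil>2 ^ n * \<bar>C\<bar>\<rceil>"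
  have coeff: "\<bar>coeff f i\<bar> \<le> K" if "degree f \<le> n" "mahler_measure f \<le> C" for f :: "int poly" and i
  proof -
    have "degree f choose i \<le> 2 ^ n"
      using binomial_le_pow2[of "degree f" i] power_increasing[OF that(1), of "2 :: nat"]
      by linarith
    then have "real (degree f choose i) \<le> real (2 ^ n)" by (rule of_nat_mono)
    then have "real (degree f choose i) \<le> 2 ^ n" by simp
    then have "real (degree f choose i) * mahler_measure f \<le> 2 ^ n * \<bar>C\<bar>"
      using that(2) mahler_measure_ge_0 by (intro mult_mono) auto
    also have "\<dots> \<le> of_int K" unfolding K_def by (rule le_of_int_ceiling)
    finally have "real_of_int \<bar>coeff f i\<bar> \<le> of_int K"
      using Mignotte_bound[of f i] by linarith
    then show ?thesis by (simp only: of_int_le_iff)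
  qed
  have "coeffs ` {f. degree f \<le> n \<and> mahler_measure f \<le> C}
      \<subseteq> {xs. set xs \<subseteq> {-K..K} \<and> length xs \<le> Suc n}"
  proof (clarify, intro conjI subsetI)
    fix f :: "int poly" and x
    assume f: "degree f \<le> n" "mahler_measure f \<le> C"
    show "length (coeffs f) \<le> Suc n"
      using f(1) by (cases "f = 0") (simp_all add: length_coeffs_degree)
    assume "x \<in> set (coeffs f)"
    then obtain i where "x = coeff f i" by (auto simp: coeffs_def split: if_splits)
    then show "x \<in> {-K..K}" using coeff[OF f, of i] by auto
  qed
  moreover have "finite {xs. set xs \<subseteq> {-K..K} \<and> length xs \<le> Suc n}"
    by (rule finite_lists_length_le) simp
  ultimately have "finite (coeffs ` {f. degree f \<le> n \<and> mahler_measure f \<le> C})"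
    by (rule finite_subset)
  then show ?thesis by (rule finite_imageD) (simp add: inj_on_def coeffs_eq_iff)
qed

lemma monic_monom_minus_1:
  assumes "n \<ge> 1"
  shows "monic (monom 1 n - 1 :: int poly)"
proof -
  have "degree (1 :: int poly) < degree (monom 1 n :: int poly)"
    using assms by (simp add: degree_monom_eq)
  then have "degree (monom 1 n + (- 1) :: int poly) = degree (monom 1 n :: int poly)"
    by (intro degree_add_eq_left) simp
  then show ?thesis using assms by (simp add: degree_monom_eq)
qed

lemma poly_of_int_monom_minus_1:
  "poly (of_int_poly (monom 1 n - 1)) x = (x :: 'a :: comm_ring_1) ^ n - 1"
  by (simp add: of_int_poly_hom.hom_minus of_int_hom.map_poly_hom_monom poly_monom)

lemma mahler_measure_monom_minus_1:
  assumes "n \<ge> 1"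
  shows "mahler_measure (monom 1 n - 1) = 1"
proof (rule mahler_measure_eq_1I[OF monic_monom_minus_1[OF assms]])
  fix \<alpha> :: complex
  assume "poly (of_int_poly (monom 1 n - 1)) \<alpha> = 0"
  then have "cmod \<alpha> ^ n = 1" by (simp add: poly_of_int_monom_minus_1 flip: norm_power)
  then show "cmod \<alpha> \<le> 1" using one_less_power[of "cmod \<alpha>" n] assms by force
qed

lemma mahler_measure_eq_1_if_dvd_monom_minus_1:
  assumes "n \<ge> 1" "h dvd monom 1 n - 1"
  shows "mahler_measure h = 1"
proof (rule antisym)
  have nz: "monom 1 n - 1 \<noteq> (0 :: int poly)"
    by (metis monic_monom_minus_1[OF assms(1)] coeff_0 zero_neq_one)
  show "mahler_measure h \<le> 1"
    using mahler_measure_dvd[OF nz assms(2)] mahler_measure_monom_minus_1[OF assms(1)] by simp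
  show "mahler_measure h \<ge> 1"
    using assms(2) nz by (intro mahler_measure_poly_ge_1) auto
qed

lemma degree_gcd_pos_if_common_root:
  fixes f g :: "int poly" and \<alpha> :: complex
  assumes "f \<noteq> 0" "poly (of_int_poly f) \<alpha> = 0" "poly (of_int_poly g) \<alpha> = 0"
  shows "degree (gcd f g) > 0"
proof (rule ccontr)
  interpret of_rat: field_hom' "of_rat :: rat \<Rightarrow> complex" ..
  have of_rat: "map_poly of_rat (of_int_poly h :: rat poly) = (of_int_poly h :: complex poly)" for h
    by (intro poly_eqI) (simp add: coeff_map_poly)
  assume "\<not> degree (gcd f g) > 0"
  then obtain c where "gcd f g = [:c:]" by (auto elim: degree_eq_zeroE)
  moreover have "gcd f g \<noteq> 0" using assms(1) by simp
  ultimately have "gcd (of_int_poly f :: rat poly) (of_int_poly g) = 1"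
    unfolding gcd_rat_to_gcd_int by auto
  then have "gcd (of_int_poly f :: complex poly) (of_int_poly g) = 1"
    unfolding of_rat[symmetric] of_rat.map_poly_gcd[symmetric] by simp
  moreover have "[:- \<alpha>, 1:] dvd gcd (of_int_poly f) (of_int_poly g)"
    using assms(2,3) by (simp add: poly_eq_0_iff_dvd)
  ultimately show False by simp
qed

lemma monic_factor_if_root_of_unity:
  fixes f :: "int poly" and \<alpha> :: complex
  assumes "monic f" "poly (of_int_poly f) \<alpha> = 0" "n \<ge> 1" "\<alpha> ^ n = 1"
  obtains h where "monic h" "degree h \<ge> 1" "h dvd f" "mahler_measure h = 1"
proof -
  define g where "g = gcd f (monom 1 n - 1)"
  have deg: "degree g > 0"
    unfolding g_def using assms
    by (intro degree_gcd_pos_if_common_root) (auto simp: poly_of_int_monom_minus_1)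
  have dvd: "g dvd f" and M: "mahler_measure g = 1"
    using assms(3) by (auto simp: g_def intro: mahler_measure_eq_1_if_dvd_monom_minus_1)
  from dvd obtain k where "f = g * k" by blast
  then have "lead_coeff g * lead_coeff k = 1" using assms(1) by (simp add: lead_coeff_mult)
  then consider (monic) "lead_coeff g = 1" | (uminus_monic) "lead_coeff g = -1" by (auto simp: zmult_eq_1_iff)
  then show ?thesis
  proof cases
    case monic
    then show ?thesis using that[of g] deg dvd M by simp
  next
    case uminus_monic
    then show ?thesis using that[of "- g"] deg dvd M by (simp add: mahler_measure_uminus)
  qed
qed

section \<open>Nonreciprocal polynomials\<close>

lemma reflect_poly_prod_linear:
  "reflect_poly (\<Prod>\<alpha>\<leftarrow>as. [:- \<alpha>, 1:]) = (\<Prod>\<alpha>\<leftarrow>as. [:1, - \<alpha> :: 'a :: idom:])"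
proof (induction as)
  case (Cons \<alpha> as)
  have "reflect_poly [:- \<alpha>, 1:] = [:1, - \<alpha>:]"
    by (intro poly_eqI) (auto simp: coeff_reflect_poly coeff_pCons split: nat.splits)
  with Cons show ?case by (simp only: list.map prod_list.Cons reflect_poly_mult)
qed simp

lemma reflect_of_int_poly:
  "reflect_poly (of_int_poly f) = (of_int_poly (reflect_poly f) :: 'a :: {comm_ring_1, ring_char_0} poly)"
  by (intro poly_eqI) (simp add: coeff_reflect_poly)

lemma fps_of_poly_prod_roots:
  assumes "monic f"
  shows "fps_of_poly (of_int_poly f) = (\<Prod>\<alpha>\<leftarrow>complex_roots_int f. fps_X - fps_const \<alpha>)"
  unfolding of_int_poly_eq_prod_roots[OF assms]
  by (simp add: fps_of_poly_prod_list o_def fps_of_poly_pCons algebra_simps flip: fps_const_neg)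

lemma fps_of_reflect_poly_prod_roots:
  assumes "monic f"
  shows "fps_of_poly (of_int_poly (reflect_poly f)) = (\<Prod>\<alpha>\<leftarrow>complex_roots_int f. 1 - fps_const \<alpha> * fps_X)"
  unfolding reflect_of_int_poly[symmetric] of_int_poly_eq_prod_roots[OF assms] reflect_poly_prod_linear
  by (simp add: fps_of_poly_prod_list o_def fps_of_poly_pCons algebra_simps flip: fps_const_neg)

lemma mset_map_cnj_roots:
  assumes "monic f"
  shows "mset (map cnj (complex_roots_int f)) = mset (complex_roots_int f)"
proof (rule reconstruct_poly_monic_defines_mset)
  interpret cnj: comm_ring_hom cnj by unfold_locales auto
  interpret map_cnj: map_poly_comm_ring_hom cnj ..
  have cnj_linear: "map_poly cnj [:- \<alpha>, 1:] = [:- cnj \<alpha>, 1:]" for \<alpha>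
    by (intro poly_eqI) (simp add: coeff_map_poly coeff_pCons split: nat.splits)
  have "map_poly cnj (\<Prod>\<alpha>\<leftarrow>as. [:- \<alpha>, 1:]) = (\<Prod>\<alpha>\<leftarrow>map cnj as. [:- \<alpha>, 1:])" for as
    by (induction as)
      (simp_all only: list.map prod_list.Cons prod_list.Nil map_cnj.hom_mult
        map_cnj.hom_one cnj_linear)
  moreover have "map_poly cnj (of_int_poly f) = of_int_poly f"
    by (intro poly_eqI) (simp add: coeff_map_poly)
  ultimately show "(\<Prod>\<alpha>\<leftarrow>map cnj (complex_roots_int f). [:- \<alpha>, 1:]) = (\<Prod>\<alpha>\<leftarrow>complex_roots_int f. [:- \<alpha>, 1:])"
    unfolding of_int_poly_eq_prod_roots[OF assms] by metis
qed

lemma prod_list_map_cong_mset: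
  fixes h :: "'a \<Rightarrow> 'b :: comm_monoid_mult"
  assumes "mset xs = mset ys"
  shows "(\<Prod>x\<leftarrow>xs. h x) = (\<Prod>y\<leftarrow>ys. h y)"
  using assms by (metis mset_map prod_mset_prod_list)

text \<open>For an analytic function this means that it is bounded by 1 on the unit disc.\<close>

definition contractive :: "complex fps \<Rightarrow> bool" where
  "contractive F \<longleftrightarrow> (\<forall>h N. (\<Sum>n\<le>N. (cmod ((F * h) $ n))\<^sup>2) \<le> (\<Sum>n\<le>N. (cmod (h $ n))\<^sup>2))"

lemma contractive_1: "contractive 1"
  by (simp add: contractive_def)

lemma contractive_const:
  assumes "cmod c \<le> 1"
  shows "contractive (fps_const c)"
  using assms unfolding contractive_def
  by (auto intro!: sum_mono mult_left_le_one_le simp: norm_mult power_mult_distrib power_le_one)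

lemma contractive_mult:
  assumes "contractive F" "contractive G"
  shows "contractive (F * G)"
  using assms unfolding contractive_def mult.assoc by (meson order_trans)

lemma contractive_prod_list:
  assumes "\<And>F. F \<in> set Fs \<Longrightarrow> contractive F"
  shows "contractive (prod_list Fs)"
  using assms by (induction Fs) (auto intro: contractive_1 contractive_mult)

lemma norm_le_1_minus_norm_square:
  fixes a b :: complex
  assumes bound: "\<And>y. (cmod a)\<^sup>2 + (cmod (b + y * a))\<^sup>2 \<le> 1 + (cmod y)\<^sup>2"
  shows "cmod b \<le> 1 - (cmod a)\<^sup>2"
proof (cases "(cmod a)\<^sup>2 < 1")
  case False
  then have "(cmod b)\<^sup>2 \<le> 0" using bound[of 0, simplified] by linarith
  then have "b = 0" by simp
  then show ?thesis using bound[of 0] by simp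
next
  case True
  define \<tau> where "\<tau> = 1 / (1 - (cmod a)\<^sup>2)"
  have \<tau>: "\<tau> > 0" "1 + \<tau> * (cmod a)\<^sup>2 = \<tau>" using True by (auto simp: \<tau>_def field_simps)
  define y where "y = of_real \<tau> * b * cnj a"
  have "b + y * a = of_real (1 + \<tau> * (cmod a)\<^sup>2) * b"
    unfolding y_def of_real_add of_real_mult complex_norm_square by (simp add: algebra_simps)
  then have "cmod (b + y * a) = \<tau> * cmod b" "cmod y = \<tau> * cmod b * cmod a"
    using \<tau> by (simp_all add: y_def norm_mult)
  then have "(\<tau> * cmod b)\<^sup>2 * (1 - (cmod a)\<^sup>2) \<le> 1 - (cmod a)\<^sup>2"
    using bound[of y] by (simp add: algebra_simps)
  then have "(\<tau> * cmod b)\<^sup>2 \<le> 1\<^sup>2" using True by simp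
  then have "\<tau> * cmod b \<le> 1" by (rule power2_le_imp_le) simp
  then show ?thesis using True by (simp add: \<tau>_def field_simps)
qed

lemma contractive_norm_nth_le:
  assumes "contractive F" "k \<ge> 1"
  shows "cmod (F $ k) \<le> 1 - (cmod (F $ 0))\<^sup>2"
proof (rule norm_le_1_minus_norm_square)
  fix y :: complex
  define h where "h = 1 + fps_const y * fps_X ^ k"
  have h: "h $ n = (if n = 0 then 1 else if n = k then y else 0)" for n
    using assms(2) by (auto simp: h_def)
  have Fh: "F * h = F + fps_const y * (F * fps_X ^ k)"
    by (simp add: h_def algebra_simps)
  have "(\<Sum>n\<in>{0,k}. (cmod ((F * h) $ n))\<^sup>2) \<le> (\<Sum>n\<le>k. (cmod ((F * h) $ n))\<^sup>2)"
    by (intro sum_mono2) auto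
  also have "\<dots> \<le> (\<Sum>n\<le>k. (cmod (h $ n))\<^sup>2)"
    using assms(1) by (simp add: contractive_def)
  also have "\<dots> = (\<Sum>n\<in>{0,k}. (cmod (h $ n))\<^sup>2)"
    by (rule sum.mono_neutral_right) (auto simp: h)
  finally show "(cmod (F $ 0))\<^sup>2 + (cmod (F $ k + y * F $ 0))\<^sup>2 \<le> 1 + (cmod y)\<^sup>2"
    using assms(2) by (simp add: Fh h fps_X_power_mult_right_nth)
qed

definition blaschke_factor :: "complex \<Rightarrow> complex fps" where
  "blaschke_factor \<alpha> = (fps_X - fps_const \<alpha>) * inverse (1 - fps_const (cnj \<alpha>) * fps_X)"

lemma blaschke_factor_mult:
  "blaschke_factor \<alpha> * (1 - fps_const (cnj \<alpha>) * fps_X) = fps_X - fps_const \<alpha>"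
  by (simp add: blaschke_factor_def mult.assoc inverse_mult_eq_1)

lemma norm_square_diff_blaschke:
  fixes a b \<alpha> :: complex
  shows "(cmod (a + cnj \<alpha> * b))\<^sup>2 - (cmod (b + \<alpha> * a))\<^sup>2 = (1 - (cmod \<alpha>)\<^sup>2) * ((cmod a)\<^sup>2 - (cmod b)\<^sup>2)"
  unfolding cmod_power2 by (simp add: power2_eq_square algebra_simps)

lemma blaschke_factor_energy_loss:
  fixes \<alpha> :: complex and h :: "complex fps"
  defines "w \<equiv> blaschke_factor \<alpha> * h"
  shows "(1 - (cmod \<alpha>)\<^sup>2) * ((\<Sum>n\<le>N. (cmod (h $ n))\<^sup>2) - (\<Sum>n\<le>N. (cmod (w $ n))\<^sup>2))
           = (cmod (h $ N + cnj \<alpha> * w $ N))\<^sup>2"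
proof -
  have "w * (1 - fps_const (cnj \<alpha>) * fps_X) = (blaschke_factor \<alpha> * (1 - fps_const (cnj \<alpha>) * fps_X)) * h"
    by (simp add: w_def mult_ac)
  then have eq: "w - fps_const (cnj \<alpha>) * (fps_X * w) = fps_X * h - fps_const \<alpha> * h"
    unfolding blaschke_factor_mult by (simp add: algebra_simps)
  show ?thesis
  proof (induction N)
    case 0
    have "w $ 0 + \<alpha> * h $ 0 = 0" using arg_cong[OF eq, of "\<lambda>F. F $ 0"] by simp
    then show ?case using norm_square_diff_blaschke[of "h $ 0" \<alpha> "w $ 0"] by simp
  next
    case (Suc N)
    have "w $ Suc N + \<alpha> * h $ Suc N = h $ N + cnj \<alpha> * w $ N"
      using arg_cong[OF eq, of "\<lambda>F. F $ Suc N"] by (simp add: algebra_simps)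
    then show ?case
      using norm_square_diff_blaschke[of "h $ Suc N" \<alpha> "w $ Suc N"] Suc.IH
      by (simp add: algebra_simps)
  qed
qed

lemma blaschke_factor_unimodular:
  assumes "cmod \<alpha> = 1"
  shows "blaschke_factor \<alpha> = fps_const (- \<alpha>)"
proof -
  have "\<alpha> * cnj \<alpha> = 1" using assms by (simp flip: complex_norm_square)
  then have eq: "fps_X - fps_const \<alpha> = fps_const (- \<alpha>) * (1 - fps_const (cnj \<alpha>) * fps_X)"
    by (simp add: right_diff_distrib flip: mult.assoc fps_const_neg)
  show ?thesis unfolding blaschke_factor_def eq by (simp add: mult.assoc inverse_mult_eq_1')
qed

lemma contractive_blaschke_factor:
  assumes "cmod \<alpha> \<le> 1"
  shows "contractive (blaschke_factor \<alpha>)"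
proof (cases "cmod \<alpha> = 1")
  case True
  then show ?thesis by (simp add: blaschke_factor_unimodular contractive_const)
next
  case False
  then have "1 - (cmod \<alpha>)\<^sup>2 > 0" using assms by (simp add: power_less_one_iff)
  moreover have "(1 - (cmod \<alpha>)\<^sup>2) * ((\<Sum>n\<le>N. (cmod (h $ n))\<^sup>2)
      - (\<Sum>n\<le>N. (cmod ((blaschke_factor \<alpha> * h) $ n))\<^sup>2)) \<ge> 0" for h N
    unfolding blaschke_factor_energy_loss by simp
  ultimately show ?thesis
    unfolding contractive_def by (simp add: zero_le_mult_iff)
qed

text \<open>For \<open>\<bar>\<alpha>\<bar> > 1\<close> it is the inverse of \<open>(X - \<alpha>) / (1 - cnj \<alpha> X)\<close> that is contractive; so the product
  of these quotients over the zeros of a polynomial becomes a quotient of two contractive series.\<close>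

definition inner_blaschke :: "complex \<Rightarrow> complex fps" where
  "inner_blaschke \<alpha> = (if cmod \<alpha> \<le> 1 then blaschke_factor \<alpha> else 1)"

definition outer_blaschke :: "complex \<Rightarrow> complex fps" where
  "outer_blaschke \<alpha> = (if cmod \<alpha> \<le> 1 then 1
     else fps_const (cnj \<alpha> / \<alpha>) * blaschke_factor (1 / cnj \<alpha>))"

lemma contractive_inner_blaschke: "contractive (inner_blaschke \<alpha>)"
  by (simp add: inner_blaschke_def contractive_1 contractive_blaschke_factor)

lemma contractive_outer_blaschke: "contractive (outer_blaschke \<alpha>)"
  by (auto simp: outer_blaschke_def norm_divide divide_le_eq_1
      intro!: contractive_1 contractive_mult contractive_const contractive_blaschke_factor)

lemma norm_outer_blaschke_0: "cmod (outer_blaschke \<alpha> $ 0) * max 1 (cmod \<alpha>) = 1"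
proof (cases "cmod \<alpha> \<le> 1")
  case False
  then have "\<alpha> \<noteq> 0" by auto
  with False show ?thesis
    by (simp add: outer_blaschke_def blaschke_factor_def norm_mult norm_divide max_def)
qed (simp add: outer_blaschke_def)

lemma outer_blaschke_mult:
  "(fps_X - fps_const \<alpha>) * outer_blaschke \<alpha> = inner_blaschke \<alpha> * (1 - fps_const (cnj \<alpha>) * fps_X)"
proof (cases "cmod \<alpha> \<le> 1")
  case True
  then show ?thesis by (simp add: inner_blaschke_def outer_blaschke_def blaschke_factor_mult)
next
  case False
  then have "\<alpha> \<noteq> 0" by auto
  then have "fps_X - fps_const \<alpha> = fps_const (- \<alpha>) * (1 - fps_const (cnj (1 / cnj \<alpha>)) * fps_X)"
    by (simp add: right_diff_distrib flip: mult.assoc fps_const_neg)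
  then have "(fps_X - fps_const \<alpha>) * outer_blaschke \<alpha>
      = fps_const (- cnj \<alpha>) * (blaschke_factor (1 / cnj \<alpha>) * (1 - fps_const (cnj (1 / cnj \<alpha>)) * fps_X))"
    using False \<open>\<alpha> \<noteq> 0\<close> by (simp add: outer_blaschke_def mult_ac)
  also have "\<dots> = 1 - fps_const (cnj \<alpha>) * fps_X"
    unfolding blaschke_factor_mult
    using \<open>\<alpha> \<noteq> 0\<close> by (simp add: right_diff_distrib flip: fps_const_neg)
  finally show ?thesis using False by (simp add: inner_blaschke_def)
qed

lemma fps_nth_subdegree_if_mult_eq:
  fixes F G H Q :: "'a :: field fps"
  assumes "H * Q = G * F" "Q $ 0 = 1"
  shows "n < subdegree G \<Longrightarrow> H $ n = 0" and "H $ subdegree G = G $ subdegree G * F $ 0"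
proof -
  have "H = G * (F * inverse Q)"
    using assms by (metis inverse_mult_eq_1' mult.assoc mult.right_neutral zero_neq_one)
  then show "n < subdegree G \<Longrightarrow> H $ n = 0" and "H $ subdegree G = G $ subdegree G * F $ 0"
    using assms(2) by (auto simp: fps_mult_nth_outside_subdegrees)
qed

lemma contractive_quotient:
  assumes "monic f"
  obtains F g where "contractive F" "contractive g"
    "fps_of_poly (of_int_poly f) * g = F * fps_of_poly (of_int_poly (reflect_poly f))"
    "cmod (g $ 0) * mahler_measure f = 1"
proof
  define as where "as = complex_roots_int f"
  let ?F = "\<Prod>\<alpha>\<leftarrow>as. inner_blaschke \<alpha>" and ?g = "\<Prod>\<alpha>\<leftarrow>as. outer_blaschke \<alpha>"
  show "contractive ?F" "contractive ?g"
    by (auto intro!: contractive_prod_list contractive_inner_blaschke contractive_outer_blaschke)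
  have "(\<Prod>\<alpha>\<leftarrow>bs. fps_X - fps_const \<alpha>) * (\<Prod>\<alpha>\<leftarrow>bs. outer_blaschke \<alpha>)
      = (\<Prod>\<alpha>\<leftarrow>bs. inner_blaschke \<alpha>) * (\<Prod>\<alpha>\<leftarrow>bs. 1 - fps_const (cnj \<alpha>) * fps_X)" for bs
  proof (induction bs)
    case (Cons \<beta> bs)
    then have "((fps_X - fps_const \<beta>) * outer_blaschke \<beta>)
          * ((\<Prod>\<alpha>\<leftarrow>bs. fps_X - fps_const \<alpha>) * (\<Prod>\<alpha>\<leftarrow>bs. outer_blaschke \<alpha>))
        = (inner_blaschke \<beta> * (1 - fps_const (cnj \<beta>) * fps_X))
          * ((\<Prod>\<alpha>\<leftarrow>bs. inner_blaschke \<alpha>) * (\<Prod>\<alpha>\<leftarrow>bs. 1 - fps_const (cnj \<alpha>) * fps_X))"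
      by (simp only: outer_blaschke_mult)
    then show ?case by (simp only: list.map prod_list.Cons mult_ac)
  qed simp
  moreover have "(\<Prod>\<alpha>\<leftarrow>as. 1 - fps_const (cnj \<alpha>) * fps_X) = (\<Prod>\<alpha>\<leftarrow>as. 1 - fps_const \<alpha> * fps_X)"
    using prod_list_map_cong_mset[OF mset_map_cnj_roots[OF assms], of "\<lambda>\<alpha>. 1 - fps_const \<alpha> * fps_X"]
    by (simp add: as_def o_def)
  ultimately show "fps_of_poly (of_int_poly f) * ?g = ?F * fps_of_poly (of_int_poly (reflect_poly f))"
    unfolding fps_of_poly_prod_roots[OF assms] fps_of_reflect_poly_prod_roots[OF assms] as_def
    by simp
  have "cmod ((\<Prod>\<alpha>\<leftarrow>bs. outer_blaschke \<alpha>) $ 0) * (\<Prod>\<alpha>\<leftarrow>bs. max 1 (cmod \<alpha>)) = 1" for bs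
  proof (induction bs)
    case (Cons \<beta> bs)
    then show ?case
      using arg_cong2[OF norm_outer_blaschke_0[of \<beta>] Cons, of "(*)"]
      by (simp add: norm_mult mult_ac)
  qed simp
  then show "cmod (?g $ 0) * mahler_measure f = 1"
    by (simp add: mahler_measure_monic_eq[OF assms] as_def)
qed

lemma norm_nth_0_le_if_contractive:
  assumes "contractive F" "contractive g"
    and eq: "(F - g) * Q = G * g" and "Q $ 0 = 1"
    and "subdegree G \<ge> 1" and "cmod (G $ subdegree G) \<ge> 1"
  shows "cmod (g $ 0) \<le> 2 * (1 - (cmod (g $ 0))\<^sup>2)"
proof -
  define k where "k = subdegree G"
  note nth = fps_nth_subdegree_if_mult_eq[OF eq \<open>Q $ 0 = 1\<close>, folded k_def]
  have "F $ 0 = g $ 0" using nth(1)[of 0] assms(5) by (simp add: k_def)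
  have "cmod (g $ 0) \<le> cmod (G $ k) * cmod (g $ 0)"
    using assms(6) mult_right_mono[of 1 "cmod (G $ k)" "cmod (g $ 0)"] by (simp add: k_def)
  also have "\<dots> = cmod (F $ k - g $ k)"
    using nth(2) by (simp add: norm_mult)
  also have "\<dots> \<le> cmod (F $ k) + cmod (g $ k)" by (rule norm_triangle_ineq4)
  also have "\<dots> \<le> 2 * (1 - (cmod (g $ 0))\<^sup>2)"
    using contractive_norm_nth_le[OF assms(1), of k] contractive_norm_nth_le[OF assms(2), of k]
      assms(5) \<open>F $ 0 = g $ 0\<close> by (simp add: k_def)
  finally show ?thesis .
qed

lemma nonreciprocal_mahler_measure_quadratic:
  assumes monic: "monic f" and f0: "\<bar>coeff f 0\<bar> = 1"
    and nonrec: "f \<noteq> reflect_poly f" "f \<noteq> - reflect_poly f"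
  defines "M \<equiv> mahler_measure f"
  shows "M \<le> 2 * (M\<^sup>2 - 1)"
proof -
  define e where "e = coeff f 0"
  have e: "e = 1 \<or> e = -1" using f0 unfolding e_def by linarith
  define P Q where "P = fps_of_poly (of_int_poly f :: complex poly)"
    and "Q = fps_of_poly (of_int_poly (reflect_poly f) :: complex poly)"
  obtain F g where F: "contractive F" and g: "contractive g"
    and quotient: "P * g = F * Q" and g0: "cmod (g $ 0) * M = 1"
    by (rule contractive_quotient[OF monic, folded P_def Q_def M_def])
  define D where "D = Polynomial.smult e f - reflect_poly f"
  define G where "G = fps_of_poly (of_int_poly D :: complex poly)"
  have "D \<noteq> 0" using e nonrec unfolding D_def
    by (metis eq_iff_diff_eq_0 minus_minus smult_1_left smult_minus_left)
  then have "G \<noteq> 0" by (simp add: G_def)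
  have "G = fps_const (of_int e) * P - Q"
    unfolding G_def D_def P_def Q_def
    by (simp add: of_int_poly_hom.hom_minus fps_of_poly_diff fps_of_poly_smult of_int_hom.map_poly_hom_smult)
  then have eq: "(fps_const (of_int e) * F - g) * Q = G * g"
    using quotient by (simp add: left_diff_distrib mult.assoc)
  have "G $ 0 = 0" using e monic by (auto simp: G_def D_def e_def[symmetric])
  then have "subdegree G \<ge> 1" using \<open>G \<noteq> 0\<close> by (metis nth_subdegree_nonzero less_one not_le)
  moreover have "cmod (G $ subdegree G) \<ge> 1"
    using nth_subdegree_nonzero[OF \<open>G \<noteq> 0\<close>] by (simp add: G_def flip: of_int_abs)
  moreover have "Q $ 0 = 1" using monic by (simp add: Q_def)
  moreover have "contractive (fps_const (of_int e) * F)"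
    using e by (auto intro!: contractive_mult contractive_const F)
  ultimately have "cmod (g $ 0) \<le> 2 * (1 - (cmod (g $ 0))\<^sup>2)"
    using norm_nth_0_le_if_contractive[OF _ g eq] by simp
  then have "cmod (g $ 0) * M\<^sup>2 \<le> 2 * (1 - (cmod (g $ 0))\<^sup>2) * M\<^sup>2"
    by (rule mult_right_mono) simp
  also have "\<dots> = 2 * (M\<^sup>2 - (cmod (g $ 0) * M)\<^sup>2)"
    by (simp add: algebra_simps power_mult_distrib)
  finally have "(cmod (g $ 0) * M) * M \<le> 2 * (M\<^sup>2 - (cmod (g $ 0) * M)\<^sup>2)"
    by (simp add: power2_eq_square mult.assoc)
  then show ?thesis unfolding g0 by simp
qed

definition nonreciprocal_bound :: real where
  "nonreciprocal_bound = (1 + sqrt 17) / 4"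

lemma abs_coeff_0_le_mahler_measure: "\<bar>coeff f 0\<bar> \<le> mahler_measure f"
  using Mignotte_bound[of f 0] by simp

lemma nonreciprocal_mahler_measure_ge:
  assumes monic: "monic f" and "coeff f 0 \<noteq> 0"
    and nonrec: "f \<noteq> reflect_poly f" "f \<noteq> - reflect_poly f"
  shows "mahler_measure f \<ge> nonreciprocal_bound"
proof (cases "\<bar>coeff f 0\<bar> = 1")
  case True
  define M where "M = mahler_measure f"
  have "M \<ge> 1" unfolding M_def using monic by (intro mahler_measure_poly_ge_1) auto
  have "M \<le> 2 * (M\<^sup>2 - 1)"
    using nonreciprocal_mahler_measure_quadratic[OF monic True nonrec] by (simp add: M_def)
  then have "17 \<le> (4 * M - 1)\<^sup>2" by (simp add: power2_eq_square algebra_simps)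
  then have "sqrt 17 \<le> 4 * M - 1" using \<open>M \<ge> 1\<close> by (intro real_le_lsqrt) auto
  then show ?thesis by (simp add: M_def nonreciprocal_bound_def)
next
  case False
  then have "\<bar>coeff f 0\<bar> \<ge> 2" using assms(2) by linarith
  then have "mahler_measure f \<ge> 2" using abs_coeff_0_le_mahler_measure[of f] by linarith
  moreover have "sqrt 17 \<le> 7" by (rule real_le_lsqrt) auto
  ultimately show ?thesis unfolding nonreciprocal_bound_def by argo
qed

section \<open>Power sums of the zeros\<close>

definition power_sum :: "'a :: comm_ring_1 list \<Rightarrow> nat \<Rightarrow> 'a" where
  "power_sum ys n = (\<Sum>y\<leftarrow>ys. y ^ n)"

definition reversed_char :: "'a :: comm_ring_1 list \<Rightarrow> 'a fps" where
  "reversed_char ys = (\<Prod>y\<leftarrow>ys. 1 - fps_const y * fps_X)"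

lemma reversed_char_Nil: "reversed_char [] = 1"
  by (simp add: reversed_char_def)

lemma reversed_char_Cons:
  "reversed_char (y # ys) = reversed_char ys - fps_const y * (fps_X * reversed_char ys)"
  by (simp add: reversed_char_def left_diff_distrib mult.assoc)

lemma reversed_char_nth_0: "reversed_char ys $ 0 = 1"
  by (induction ys) (simp_all add: reversed_char_Nil reversed_char_Cons)

lemma reversed_char_nth_eq_0: "n > length ys \<Longrightarrow> reversed_char ys $ n = 0"
proof (induction ys arbitrary: n)
  case (Cons y ys)
  then show ?case by (cases n) (auto simp: reversed_char_Cons)
qed (simp add: reversed_char_Nil)

lemma reversed_char_nth_length: "reversed_char ys $ length ys = (\<Prod>y\<leftarrow>ys. - y)"
  by (induction ys) (simp_all add: reversed_char_Nil reversed_char_Cons reversed_char_nth_eq_0)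

lemma newton_fps:
  "fps_X * fps_deriv (reversed_char ys)
     = - (reversed_char ys * Abs_fps (\<lambda>n. if n = 0 then 0 else power_sum ys n))"
proof (induction ys)
  case Nil
  show ?case by (rule fps_ext) (simp add: reversed_char_Nil power_sum_def)
next
  case (Cons y ys)
  define L where "L = 1 - fps_const y * fps_X"
  define E S where "E = reversed_char ys" and "S = Abs_fps (\<lambda>n. if n = 0 then 0 else power_sum ys n)"
  define G where "G = Abs_fps (\<lambda>n. if n = 0 then 0 else y ^ n)"
  have geometric: "L * G = fps_const y * fps_X"
  proof (rule fps_ext)
    fix n
    show "(L * G) $ n = (fps_const y * fps_X) $ n"
      by (cases n) (auto simp: L_def G_def left_diff_distrib mult.assoc fps_X_nth)
  qed
  have S: "Abs_fps (\<lambda>n. if n = 0 then 0 else power_sum (y # ys) n) = G + S"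
    by (rule fps_ext) (simp add: G_def S_def power_sum_def)
  have E: "reversed_char (y # ys) = L * E"
    by (simp add: reversed_char_def E_def L_def)
  have "fps_deriv L = - fps_const y" by (simp add: L_def)
  then have "fps_X * fps_deriv (L * E) = L * (fps_X * fps_deriv E) - (L * G) * E"
    unfolding geometric by (simp add: algebra_simps flip: fps_const_neg)
  also have "\<dots> = - (L * E * (G + S))"
    unfolding Cons.IH[folded E_def S_def] by (simp add: algebra_simps)
  finally show ?case unfolding S E .
qed

lemma newton_identity:
  "of_nat n * reversed_char ys $ n = - (\<Sum>i<n. reversed_char ys $ i * power_sum ys (n - i))"
proof -
  have "of_nat n * reversed_char ys $ n = (fps_X * fps_deriv (reversed_char ys)) $ n"
    by (cases n) auto
  also have "\<dots> = - (\<Sum>i=0..n. reversed_char ys $ i * (if n - i = 0 then 0 else power_sum ys (n - i)))"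
    by (simp add: newton_fps fps_mult_nth)
  also have "(\<Sum>i=0..n. reversed_char ys $ i * (if n - i = 0 then 0 else power_sum ys (n - i)))
      = (\<Sum>i<n. reversed_char ys $ i * power_sum ys (n - i))"
    by (rule sum.mono_neutral_cong_right) auto
  finally show ?thesis .
qed

lemma fact_mult_reversed_char_Ints:
  assumes "\<And>n. power_sum ys n \<in> \<int>"
  shows "fact n * reversed_char ys $ n \<in> \<int>"
proof (induction n rule: less_induct)
  case (less n)
  show ?case
  proof (cases n)
    case 0
    then show ?thesis by (simp add: reversed_char_nth_0)
  next
    case (Suc m)
    have "fact m * reversed_char ys $ i * power_sum ys (n - i) \<in> \<int>" if "i < n" for i
    proof -
      have "i \<le> m" using that Suc by simp
      then obtain k where "(fact m :: nat) = fact i * k" using fact_dvd[of i m] by blast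
      then have "(fact m :: 'a) = of_nat k * fact i"
        by (metis mult.commute of_nat_fact of_nat_mult)
      then have "fact m * reversed_char ys $ i * power_sum ys (n - i)
          = of_nat k * (fact i * reversed_char ys $ i) * power_sum ys (n - i)"
        by (simp only: mult.assoc)
      then show ?thesis
        using less.IH[OF that] assms by (simp only: Ints_mult Ints_of_nat)
    qed
    then have "- (\<Sum>i<n. fact m * reversed_char ys $ i * power_sum ys (n - i)) \<in> \<int>"
      by (intro Ints_minus Ints_sum) auto
    also have "- (\<Sum>i<n. fact m * reversed_char ys $ i * power_sum ys (n - i))
        = fact m * (of_nat n * reversed_char ys $ n)"
      by (simp add: newton_identity sum_distrib_left mult.assoc)
    also have "\<dots> = fact n * reversed_char ys $ n"
      by (simp add: Suc algebra_simps)
    finally show ?thesis .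
  qed
qed

lemma fact_mult_prod_list_Ints:
  assumes "\<And>n. power_sum ys n \<in> \<int>"
  shows "fact (length ys) * prod_list ys \<in> \<int>"
proof -
  have "prod_list ys = (-1) ^ length ys * (\<Prod>y\<leftarrow>ys. - y)"
    by (induction ys) simp_all
  then have "fact (length ys) * prod_list ys = (-1) ^ length ys * (fact (length ys) * reversed_char ys $ length ys)"
    by (simp add: reversed_char_nth_length mult.left_commute)
  also have "\<dots> \<in> \<int>"
    by (intro Ints_mult Ints_power Ints_minus Ints_1 fact_mult_reversed_char_Ints assms)
  finally show ?thesis .
qed

lemma reversed_char_roots_nth:
  assumes "monic q"
  shows "reversed_char (complex_roots_int q) $ n = of_int (coeff (reflect_poly q) n)"
  using fps_of_reflect_poly_prod_roots[OF assms] unfolding reversed_char_def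
  by (metis fps_of_poly_nth of_int_hom.coeff_map_poly_hom)

lemma power_sum_roots_recursion:
  assumes "monic q" "n \<ge> 1"
  shows "power_sum (complex_roots_int q) n
    = - (of_int (int n * coeff (reflect_poly q) n)
         + (\<Sum>i=1..<n. of_int (coeff (reflect_poly q) i) * power_sum (complex_roots_int q) (n - i)))"
proof -
  have "{..<n} = insert 0 {1..<n}" using assms(2) by auto
  then show ?thesis
    using newton_identity[of n "complex_roots_int q"] assms
    by (simp add: reversed_char_roots_nth algebra_simps)
qed

lemma power_sum_roots_Ints:
  assumes "monic q"
  shows "power_sum (complex_roots_int q) n \<in> \<int>"
proof (induction n rule: less_induct)
  case (less n)
  show ?case
  proof (cases "n = 0")
    case True
    then show ?thesis by (simp add: power_sum_def sum_list_triv)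
  next
    case False
    then show ?thesis
      using less by (subst power_sum_roots_recursion[OF assms])
        (auto intro!: Ints_minus Ints_add Ints_mult Ints_sum simp del: of_int_mult)
  qed
qed

lemma sum_poly_roots_Ints:
  assumes "monic q"
  shows "(\<Sum>\<alpha>\<leftarrow>complex_roots_int q. poly (of_int_poly P) \<alpha>) \<in> \<int>"
proof -
  have "(\<Sum>\<alpha>\<leftarrow>xs. poly (of_int_poly P) \<alpha>)
      = (\<Sum>i\<le>degree P. of_int (coeff P i) * power_sum xs i)" for xs :: "complex list"
    by (induction xs)
       (simp_all add: power_sum_def poly_altdef sum.distrib distrib_left)
  then show ?thesis using power_sum_roots_Ints[OF assms]
    by (auto intro!: Ints_sum Ints_mult)
qed

lemma norm_ge_1_if_Ints:
  fixes x :: "'a :: real_normed_algebra_1"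
  assumes "x \<in> \<int>" "x \<noteq> 0"
  shows "norm x \<ge> 1"
  using assms by (elim Ints_cases) (auto simp flip: of_int_abs)

lemma norm_ge_1_if_multiples_of_powers_Ints:
  fixes x c :: "'a :: real_normed_field"
  assumes "x \<noteq> 0" "c \<noteq> 0" and int: "\<And>m. c * x ^ m \<in> \<int>"
  shows "norm x \<ge> 1"
proof (rule ccontr)
  assume "\<not> norm x \<ge> 1"
  then have "(\<lambda>m. norm c * norm x ^ m) \<longlonglongrightarrow> norm c * 0"
    by (intro tendsto_intros LIMSEQ_power_zero) auto
  then have "eventually (\<lambda>m. norm c * norm x ^ m < 1) sequentially"
    by (rule order_tendstoD) simp
  then obtain m where "norm (c * x ^ m) < 1"
    by (auto simp: eventually_sequentially norm_mult norm_power)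
  then show False using norm_ge_1_if_Ints[OF int[of m]] assms(1,2) by simp
qed

text \<open>Newton's identities only give \<open>n! \<Prod> P(\<alpha>) \<in> \<int>\<close>; applied to all powers of \<open>P\<close> this
  still excludes \<open>\<bar>\<Prod> P(\<alpha>)\<bar> < 1\<close>.\<close>

lemma norm_prod_poly_roots_ge_1:
  assumes "monic q" and nz: "\<And>\<alpha>. \<alpha> \<in> set (complex_roots_int q) \<Longrightarrow> poly (of_int_poly P) \<alpha> \<noteq> 0"
  shows "(\<Prod>\<alpha>\<leftarrow>complex_roots_int q. cmod (poly (of_int_poly P) \<alpha>)) \<ge> 1"
proof -
  define as where "as = complex_roots_int q"
  define x where "x = (\<Prod>\<alpha>\<leftarrow>as. poly (of_int_poly P) \<alpha>)"
  have "fact (length as) * x ^ m \<in> \<int>" for m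
  proof -
    define ys where "ys = map (\<lambda>\<alpha>. poly (of_int_poly (P ^ m)) \<alpha>) as"
    have "power_sum ys n = (\<Sum>\<alpha>\<leftarrow>as. poly (of_int_poly (P ^ (m * n))) \<alpha>)" for n
      by (simp add: power_sum_def ys_def o_def of_int_poly_hom.hom_power poly_power power_mult)
    then have "fact (length ys) * prod_list ys \<in> \<int>"
      using sum_poly_roots_Ints[OF assms(1)] by (intro fact_mult_prod_list_Ints) (simp add: as_def)
    moreover have "prod_list ys = x ^ m"
      by (simp add: ys_def x_def prod_list_power o_def of_int_poly_hom.hom_power poly_power)
    ultimately show ?thesis by (simp add: ys_def)
  qed
  moreover have "x \<noteq> 0" using nz by (auto simp: x_def as_def prod_list_zero_iff)
  ultimately have "cmod x \<ge> 1"
    by (intro norm_ge_1_if_multiples_of_powers_Ints[of x "fact (length as)"]) auto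
  then show ?thesis by (simp add: x_def as_def)
qed

section \<open>The auxiliary function\<close>

lemma quadratic_le_on_interval:
  fixes p r s x x0 x1 A :: real
  assumes "p \<ge> 0" "x0 \<le> x" "x \<le> x1"
    and "p * x0\<^sup>2 + r * x0 + s \<le> A" "p * x1\<^sup>2 + r * x1 + s \<le> A"
  shows "p * x\<^sup>2 + r * x + s \<le> A"
proof (cases "x0 = x1")
  case False
  then have pos: "x1 - x0 > 0" using assms by simp
  have "p * ((x - x0) * (x1 - x)) * (x1 - x0) \<ge> 0"
    using assms pos by (intro mult_nonneg_nonneg) auto
  moreover have "(x1 - x) * (p * x0\<^sup>2 + r * x0 + s) \<le> (x1 - x) * A"
    using assms by (intro mult_left_mono) auto
  moreover have "(x - x0) * (p * x1\<^sup>2 + r * x1 + s) \<le> (x - x0) * A"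
    using assms by (intro mult_left_mono) auto
  ultimately have "(x1 - x0) * (p * x\<^sup>2 + r * x + s) \<le> (x1 - x0) * A"
    by (simp add: algebra_simps power2_eq_square)
  then show ?thesis using pos by simp
qed (use assms in auto)

text \<open>As a function of \<open>y\<^sup>2\<close> the expression is convex, although in \<open>y\<close> it need not be.\<close>

lemma quartic_le_on_interval:
  fixes p r s e y y0 y1 A :: real
  assumes "p \<ge> 0" "e \<ge> 0" "0 \<le> y0" "y0 \<le> y" "y \<le> y1"
    and "p * (y0\<^sup>2)\<^sup>2 + r * y0\<^sup>2 - e * y0 + s \<le> A" "p * (y1\<^sup>2)\<^sup>2 + r * y1\<^sup>2 - e * y1 + s \<le> A"
  shows "p * (y\<^sup>2)\<^sup>2 + r * y\<^sup>2 - e * y + s \<le> A"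
proof (cases "y1 = 0")
  case True
  then have "y = y1" using assms by linarith
  then show ?thesis using assms by simp
next
  case False
  then have "y0 + y1 > 0" using assms by linarith
  define e' where "e' = e / (y0 + y1)"
  have "e' \<ge> 0" and e: "e = e' * (y0 + y1)" using assms \<open>y0 + y1 > 0\<close> by (auto simp: e'_def)
  have "p * (y\<^sup>2)\<^sup>2 + (r - e') * y\<^sup>2 + (s - e' * y0 * y1) \<le> A"
  proof (rule quadratic_le_on_interval)
    show "p * (y0\<^sup>2)\<^sup>2 + (r - e') * y0\<^sup>2 + (s - e' * y0 * y1) \<le> A"
      using assms(6) e by (simp add: algebra_simps power2_eq_square)
    show "p * (y1\<^sup>2)\<^sup>2 + (r - e') * y1\<^sup>2 + (s - e' * y0 * y1) \<le> A"
      using assms(7) e by (simp add: algebra_simps power2_eq_square)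
  qed (use assms in \<open>auto intro: power_mono\<close>)
  moreover have "e' * ((y - y0) * (y1 - y)) \<ge> 0"
    using \<open>e' \<ge> 0\<close> assms by (intro mult_nonneg_nonneg) auto
  ultimately show ?thesis using e by (simp add: algebra_simps power2_eq_square)
qed

text \<open>With \<open>z = r e\<^sup>i\<^sup>\<theta>\<close>, \<open>x = 2 cos \<theta>\<close> and \<open>\<delta> = r + 1/r - 2\<close>, these are the squares of
  \<open>\<bar>\<Phi>\<^sub>1(z)\<bar> / r\<^sup>1\<^sup>/\<^sup>2\<close> and \<open>\<bar>\<Phi>\<^sub>6(z)\<bar> / r\<close> for the cyclotomic polynomials \<open>\<Phi>\<^sub>1\<close> and \<open>\<Phi>\<^sub>6\<close>.\<close>

definition sq_Phi1 :: "real \<Rightarrow> real \<Rightarrow> real" where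
  "sq_Phi1 x \<delta> = 2 + \<delta> - x"

definition sq_Phi6 :: "real \<Rightarrow> real \<Rightarrow> real" where
  "sq_Phi6 x \<delta> = (x - 1)\<^sup>2 + \<delta> * (4 - x + \<delta>)"

text \<open>Powers of \<open>11/10\<close> serve as the points of tangency \<open>t\<close> in \<open>ln u \<le> u / t - 1 + ln t\<close>.\<close>

definition base_power :: "int \<Rightarrow> real" where
  "base_power n = (if n \<ge> 0 then (11/10) ^ nat n else (10/11) ^ nat (- n))"

definition ln_base_power :: "int \<Rightarrow> real" where
  "ln_base_power n = of_int n * (if n \<ge> 0 then 9532/100000 else 953/10000)"

lemma ln_11_10_bounds: "ln (11/10 :: real) \<ge> 953/10000" "ln (11/10 :: real) \<le> 9532/100000"
  using ln_approx_bounds[of "11/10" 2] by (simp_all add: lessThan_Suc numeral_2_eq_2)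

lemma base_power_pos: "base_power n > 0"
  by (simp add: base_power_def)

lemma ln_base_power_le: "ln (base_power n) \<le> ln_base_power n"
proof (cases "n \<ge> 0")
  case True
  then show ?thesis
    using mult_left_mono[OF ln_11_10_bounds(2), of "of_int n"]
    by (simp add: base_power_def ln_base_power_def ln_realpow)
next
  case False
  have "ln (10/11 :: real) = - ln (11/10)" by (simp add: ln_div)
  with False show ?thesis
    using mult_left_mono[OF ln_11_10_bounds(1), of "of_int (- n)"]
    by (simp add: base_power_def ln_base_power_def ln_realpow)
qed

lemma ln_le_tangent:
  fixes t u :: real
  assumes "t > 0" "u > 0"
  shows "ln u \<le> u / t - 1 + ln t"
proof -
  have "ln (u / t) \<le> u / t - 1" using assms by (intro ln_le_minus_one) auto
  then show ?thesis using assms by (simp add: ln_div)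
qed

lemma ln_le_tangent_base_power:
  assumes "u > 0"
  shows "ln u \<le> u / base_power n - 1 + ln_base_power n"
  using ln_le_tangent[OF base_power_pos assms, of n] ln_base_power_le[of n] by linarith

text \<open>Both logarithms of the auxiliary function are replaced by tangents, with \<open>\<delta> = y\<^sup>2\<close>. The weights
  \<open>37/50\<close> and \<open>2/5\<close> were found numerically; they nearly minimise the constant \<open>543/1000\<close> below.\<close>

definition majorant :: "int \<Rightarrow> int \<Rightarrow> real \<Rightarrow> real \<Rightarrow> real" where
  "majorant m n x y = (2 + y\<^sup>2) * x / 2
     + 37/50 * (sq_Phi1 x (y\<^sup>2) / base_power m - 1 + ln_base_power m)
     + 2/5 * (sq_Phi6 x (y\<^sup>2) / base_power n - 1 + ln_base_power n)
     - 5/2 * y\<^sup>2 - 4/5 * y"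

lemma majorant_le_on_box:
  assumes x: "x0 \<le> x" "x \<le> x1" and y: "0 \<le> y0" "y0 \<le> y" "y \<le> y1"
    and corners: "majorant m n x0 y0 \<le> A" "majorant m n x1 y0 \<le> A"
      "majorant m n x0 y1 \<le> A" "majorant m n x1 y1 \<le> A"
  shows "majorant m n x y \<le> A"
proof -
  define a b where "a = 37/50 / base_power m" and "b = 2/5 / base_power n"
  define k where "k = 37/50 * (ln_base_power m - 1) + 2/5 * (ln_base_power n - 1)"
  have "b \<ge> 0" using base_power_pos[of n] by (simp add: b_def)
  have majorant: "majorant m n x y = (2 + y\<^sup>2) * x / 2 + a * sq_Phi1 x (y\<^sup>2) + b * sq_Phi6 x (y\<^sup>2)
      + k - 5/2 * y\<^sup>2 - 4/5 * y" for x y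
    by (simp add: majorant_def a_def b_def k_def algebra_simps add_divide_distrib diff_divide_distrib)
  have quadratic_x: "majorant m n x y = b * x\<^sup>2 + ((2 + y\<^sup>2) / 2 - a - b * (2 + y\<^sup>2)) * x
      + (a * (2 + y\<^sup>2) + b * (1 + y\<^sup>2 * (4 + y\<^sup>2)) + k - 5/2 * y\<^sup>2 - 4/5 * y)" for x y
    unfolding majorant sq_Phi1_def sq_Phi6_def
    by (simp add: algebra_simps power2_eq_square add_divide_distrib)
  have quartic_y: "majorant m n x y = b * (y\<^sup>2)\<^sup>2 + (x / 2 + a + b * (4 - x) - 5/2) * y\<^sup>2 - 4/5 * y
      + (x + a * (2 - x) + b * (x - 1)\<^sup>2 + k)" for x y
    unfolding majorant sq_Phi1_def sq_Phi6_def
    by (simp add: algebra_simps power2_eq_square add_divide_distrib)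
  have edge: "majorant m n x y' \<le> A" if "majorant m n x0 y' \<le> A" "majorant m n x1 y' \<le> A" for y'
    using that unfolding quadratic_x by (rule quadratic_le_on_interval[OF \<open>b \<ge> 0\<close> x])
  have "(0 :: real) \<le> 4/5" by simp
  then show ?thesis
    using edge[OF corners(1,2)] edge[OF corners(3,4)]
    unfolding quartic_y by (rule quartic_le_on_interval[OF \<open>b \<ge> 0\<close> _ y])
qed

datatype box_tree = Leaf int int | SplitX real box_tree box_tree | SplitY real box_tree box_tree

fun box_tree_ok :: "real \<Rightarrow> box_tree \<Rightarrow> real \<Rightarrow> real \<Rightarrow> real \<Rightarrow> real \<Rightarrow> bool" where
  "box_tree_ok A (Leaf m n) x0 x1 y0 y1 \<longleftrightarrow>
     majorant m n x0 y0 \<le> A \<and> majorant m n x1 y0 \<le> A \<and>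
     majorant m n x0 y1 \<le> A \<and> majorant m n x1 y1 \<le> A"
| "box_tree_ok A (SplitX x s t) x0 x1 y0 y1 \<longleftrightarrow>
     box_tree_ok A s x0 x y0 y1 \<and> box_tree_ok A t x x1 y0 y1"
| "box_tree_ok A (SplitY y s t) x0 x1 y0 y1 \<longleftrightarrow>
     0 \<le> y \<and> box_tree_ok A s x0 x1 y0 y \<and> box_tree_ok A t x0 x1 y y1"

lemma box_tree_ok_imp_majorant_le:
  assumes "box_tree_ok A t x0 x1 y0 y1" "x0 \<le> x" "x \<le> x1" "0 \<le> y0" "y0 \<le> y" "y \<le> y1"
  obtains m n where "majorant m n x y \<le> A"
proof -
  have "\<exists>m n. majorant m n x y \<le> A"
    using assms
  proof (induction t arbitrary: x0 x1 y0 y1)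
    case (Leaf m n)
    then show ?case using majorant_le_on_box[of x0 x x1 y0 y y1 m n A] by auto
  next
    case (SplitX x' s t)
    show ?case
      using SplitX.IH(1)[of x0 x' y0 y1] SplitX.IH(2)[of x' x1 y0 y1] SplitX.prems
      by (cases "x \<le> x'") auto
  next
    case (SplitY y' s t)
    show ?case
      using SplitY.IH(1)[of x0 x1 y0 y'] SplitY.IH(2)[of x0 x1 y' y1] SplitY.prems
      by (cases "y \<le> y'") auto
  qed
  then show ?thesis using that by blast
qed

lemma box_tree_certificate:
  "box_tree_ok (543/1000)
    (SplitY 1
      (SplitX 0
        (SplitX (-1)
          (Leaf 12 15)
          (SplitX (-1/2)
            (Leaf 10 10)
            (SplitY (1/2) (SplitX (-1/4) (Leaf 9 5) (Leaf 8 3)) (Leaf 9 8))))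
        (SplitX 1
          (SplitY (1/2) (SplitX (1/2) (Leaf 7 (-1)) (Leaf 3 (-8))) (Leaf 2 3))
          (SplitY (1/2)
            (SplitX (3/2)
              (Leaf (-5) (-7))
              (SplitY (1/4)
                (SplitX (7/4)
                  (SplitX (13/8) (Leaf (-10) (-10)) (Leaf (-12) (-9)))
                  (Leaf (-15) (-6)))
                (SplitX (7/4) (Leaf (-8) (-1)) (Leaf (-9) 1))))
            (SplitY (3/4) (SplitX (3/2) (Leaf (-3) 0) (Leaf (-7) 5)) (Leaf (-3) 9)))))
      (SplitY (3/2) (Leaf 8 16) (Leaf 11 25)))
    (-2) 2 0 2"
  by (simp add: majorant_def sq_Phi1_def sq_Phi6_def base_power_def ln_base_power_def power_divide)

lemma auxiliary_inequality_near_circle: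
  fixes x \<delta> :: real
  assumes "\<bar>x\<bar> \<le> 2" and \<delta>: "\<delta> \<ge> 0" "sqrt \<delta> \<le> 2"
    and pos: "sq_Phi1 x \<delta> > 0" "sq_Phi6 x \<delta> > 0"
  shows "(2 + \<delta>) * x / 2 + 37/50 * ln (sq_Phi1 x \<delta>) + 2/5 * ln (sq_Phi6 x \<delta>)
           \<le> 543/1000 + (5/2 * \<delta> + 4/5 * sqrt \<delta>)"
proof -
  obtain m n where "majorant m n x (sqrt \<delta>) \<le> 543/1000"
    using assms
    by (auto simp: abs_le_iff intro: box_tree_ok_imp_majorant_le[OF box_tree_certificate, of x "sqrt \<delta>"])
  then show ?thesis
    using ln_le_tangent_base_power[OF pos(1), of m] ln_le_tangent_base_power[OF pos(2), of n] \<delta>(1)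
    unfolding majorant_def real_sqrt_pow2[OF \<delta>(1)] by argo
qed

lemma auxiliary_inequality_far_from_circle:
  fixes x \<delta> :: real
  assumes x: "\<bar>x\<bar> \<le> 2" and "sqrt \<delta> \<ge> 2"
    and pos: "sq_Phi1 x \<delta> > 0" "sq_Phi6 x \<delta> > 0"
  shows "(2 + \<delta>) * x / 2 + 37/50 * ln (sq_Phi1 x \<delta>) + 2/5 * ln (sq_Phi6 x \<delta>)
           \<le> 543/1000 + (5/2 * \<delta> + 4/5 * sqrt \<delta>)"
proof -
  have \<delta>: "\<delta> \<ge> 4" using real_sqrt_le_iff[of 4 \<delta>] assms(2) by simp
  have ln2: "ln (2 :: real) \<le> 7/10" using ln2_le_25_over_36 by simp
  have "(2 + \<delta>) * x / 2 \<le> 2 + \<delta>"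
    using mult_left_mono[of x 2 "2 + \<delta>"] x \<delta> by (simp add: abs_le_iff)
  moreover have "ln (sq_Phi1 x \<delta>) \<le> (4 + \<delta>) / 2 - 3/10"
    using ln_le_tangent[of 2 "sq_Phi1 x \<delta>"] ln2 pos x
    by (simp add: sq_Phi1_def abs_le_iff field_simps)
  moreover have "ln (sq_Phi6 x \<delta>) \<le> (3 + \<delta>) - 6/10"
  proof -
    have "(x - 1)\<^sup>2 \<le> 3\<^sup>2" using x by (intro abs_le_square_iff[THEN iffD1]) (auto simp: abs_le_iff)
    moreover have "\<delta> * (4 - x + \<delta>) \<le> \<delta> * (6 + \<delta>)" using x \<delta> by (intro mult_left_mono) auto
    ultimately have "sq_Phi6 x \<delta> \<le> (3 + \<delta>)\<^sup>2"
      by (simp add: sq_Phi6_def power2_eq_square algebra_simps)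
    then have "ln (sq_Phi6 x \<delta>) \<le> ln ((3 + \<delta>)\<^sup>2)"
      using pos \<delta> by (subst ln_le_cancel_iff) auto
    also have "\<dots> = 2 * ln (3 + \<delta>)" using \<delta> by (simp add: ln_realpow)
    finally show ?thesis using ln_le_tangent[of 2 "3 + \<delta>"] ln2 \<delta> by argo
  qed
  ultimately show ?thesis using assms(2) \<delta> by argo
qed

definition excess :: "real \<Rightarrow> real" where
  "excess r = r + 1 / r - 2"

lemma excess_eq_square:
  assumes "r > 0"
  shows "excess r = (sqrt r - 1 / sqrt r)\<^sup>2"
  using assms by (simp add: excess_def power2_diff power_divide)

lemma excess_nonneg:
  assumes "r > 0"
  shows "excess r \<ge> 0"
  by (simp add: excess_eq_square[OF assms])

lemma sqrt_excess:
  assumes "r \<ge> 1"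
  shows "sqrt (excess r) = sqrt r - 1 / sqrt r"
proof -
  have "1 / sqrt r \<le> 1" "1 \<le> sqrt r" using assms by auto
  then have "sqrt r - 1 / sqrt r \<ge> 0" by linarith
  then show ?thesis using assms by (simp add: excess_eq_square)
qed

lemma Re_add_inverse_eq_excess:
  assumes "z \<noteq> 0"
  shows "Re (z + 1 / z) = (2 + excess (cmod z)) * (2 * Re z / cmod z) / 2"
proof -
  have "Re (1 / z) = Re z / (cmod z)\<^sup>2" by (simp add: Re_divide cmod_power2)
  then show ?thesis using assms by (simp add: excess_def distrib_right power2_eq_square)
qed

lemma norm_square_add_inverse:
  assumes "z \<noteq> 0"
  shows "(cmod (z + 1 / z))\<^sup>2 = (2 + excess (cmod z))\<^sup>2 - 4 + (2 * Re z / cmod z)\<^sup>2"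
proof -
  define r where "r = cmod z"
  have "r \<noteq> 0" using assms by (simp add: r_def)
  have "z + 1 / z = (z\<^sup>2 + 1) / z" using assms by (simp add: add_divide_distrib power2_eq_square)
  then have "(cmod (z + 1 / z))\<^sup>2 = (cmod (z\<^sup>2 + 1))\<^sup>2 / r\<^sup>2"
    by (simp add: norm_divide power_divide r_def)
  also have "(cmod (z\<^sup>2 + 1))\<^sup>2 = (r\<^sup>2 + 1)\<^sup>2 - 4 * r\<^sup>2 + 4 * (Re z)\<^sup>2"
    unfolding r_def cmod_power2 by (simp add: power2_eq_square algebra_simps)
  also have "\<dots> / r\<^sup>2 = ((r\<^sup>2 + 1) / r)\<^sup>2 - 4 + (2 * Re z / r)\<^sup>2"
    using \<open>r \<noteq> 0\<close>
    by (simp only: add_divide_distrib[of _ _ "r\<^sup>2"] diff_divide_distrib[of _ _ "r\<^sup>2"] power_divide power_mult_distrib) simp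
  also have "(r\<^sup>2 + 1) / r = 2 + excess r"
    using \<open>r \<noteq> 0\<close> by (simp add: excess_def add_divide_distrib power2_eq_square)
  finally show ?thesis by (simp only: r_def)
qed

lemma sq_Phi1_norm:
  assumes "z \<noteq> 0"
  shows "sq_Phi1 (2 * Re z / cmod z) (excess (cmod z)) = (cmod (1 - z))\<^sup>2 / cmod z"
proof -
  have "(cmod (1 - z))\<^sup>2 = cmod z * cmod z + 1 - 2 * Re z"
    unfolding power2_eq_square[symmetric] cmod_power2 by (simp add: power2_eq_square algebra_simps)
  then show ?thesis
    using assms by (simp add: sq_Phi1_def excess_def add_divide_distrib diff_divide_distrib)
qed

lemma sq_Phi6_norm:
  assumes "z \<noteq> 0"
  shows "sq_Phi6 (2 * Re z / cmod z) (excess (cmod z)) = (cmod (z\<^sup>2 - z + 1))\<^sup>2 / (cmod z)\<^sup>2"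
proof -
  define w x \<delta> where "w = z + 1 / z" and "x = 2 * Re z / cmod z" and "\<delta> = excess (cmod z)"
  have "z\<^sup>2 - z + 1 = z * (w - 1)"
    using assms by (simp add: w_def algebra_simps power2_eq_square)
  then have "(cmod (z\<^sup>2 - z + 1))\<^sup>2 / (cmod z)\<^sup>2 = (cmod (w - 1))\<^sup>2"
    using assms by (simp add: norm_mult power_mult_distrib)
  also have "\<dots> = (cmod w)\<^sup>2 - 2 * Re w + 1"
    unfolding cmod_power2 by (simp add: power2_eq_square algebra_simps)
  also have "\<dots> = (2 + \<delta>)\<^sup>2 - 4 + x\<^sup>2 - (2 + \<delta>) * x + 1"
    unfolding w_def norm_square_add_inverse[OF assms] Re_add_inverse_eq_excess[OF assms] x_def \<delta>_def
    by simp
  also have "\<dots> = sq_Phi6 x \<delta>"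
    by (simp add: sq_Phi6_def power2_eq_square algebra_simps)
  finally show ?thesis by (simp add: x_def \<delta>_def)
qed

definition loss :: "real \<Rightarrow> real" where
  "loss r = 5/2 * excess r + 4/5 * sqrt (excess r)"

lemma auxiliary_inequality:
  fixes z :: complex
  assumes "z \<noteq> 0" "z \<noteq> 1" "z\<^sup>2 - z + 1 \<noteq> 0"
  shows "Re z + Re (1 / z) + 37/50 * ln ((cmod (1 - z))\<^sup>2 / cmod z)
      + 2/5 * ln ((cmod (z\<^sup>2 - z + 1))\<^sup>2 / (cmod z)\<^sup>2) \<le> 543/1000 + loss (cmod z)"
proof -
  define x \<delta> where "x = 2 * Re z / cmod z" and "\<delta> = excess (cmod z)"
  have "\<bar>x\<bar> \<le> 2" using abs_Re_le_cmod[of z] assms(1) by (simp add: x_def field_simps)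
  moreover have "\<delta> \<ge> 0" using assms(1) by (simp add: \<delta>_def excess_nonneg)
  moreover have "sq_Phi1 x \<delta> > 0" "sq_Phi6 x \<delta> > 0"
    unfolding x_def \<delta>_def sq_Phi1_norm[OF assms(1)] sq_Phi6_norm[OF assms(1)] using assms by auto
  ultimately have "(2 + \<delta>) * x / 2 + 37/50 * ln (sq_Phi1 x \<delta>) + 2/5 * ln (sq_Phi6 x \<delta>)
      \<le> 543/1000 + (5/2 * \<delta> + 4/5 * sqrt \<delta>)"
    using auxiliary_inequality_near_circle auxiliary_inequality_far_from_circle
    by (cases "sqrt \<delta> \<le> 2") auto
  moreover have "Re z + Re (1 / z) = (2 + \<delta>) * x / 2"
    using Re_add_inverse_eq_excess[OF assms(1)] by (simp add: x_def \<delta>_def)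
  ultimately show ?thesis
    unfolding loss_def x_def \<delta>_def sq_Phi1_norm[OF assms(1)] sq_Phi6_norm[OF assms(1)] by simp
qed

section \<open>Bounds for the power sums\<close>

definition mult_superadditive :: "(real \<Rightarrow> real) \<Rightarrow> bool" where
  "mult_superadditive g \<longleftrightarrow> g 1 = 0 \<and> (\<forall>r\<ge>1. \<forall>s\<ge>1. g r + g s \<le> g (r * s))"

lemma mult_superadditive_excess: "mult_superadditive excess"
  unfolding mult_superadditive_def
proof (intro conjI allI impI)
  fix r s :: real
  assume "r \<ge> 1" "s \<ge> 1"
  moreover from this have "(r - 1) * (s - 1) + (1 - 1 / r) * (1 - 1 / s) \<ge> 0"
    by (intro add_nonneg_nonneg mult_nonneg_nonneg) auto
  ultimately show "excess r + excess s \<le> excess (r * s)"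
    by (simp add: excess_def algebra_simps)
qed (simp add: excess_def)

lemma mult_superadditive_sqrt_excess: "mult_superadditive (\<lambda>r. sqrt (excess r))"
  unfolding mult_superadditive_def
proof (intro conjI allI impI)
  fix r s :: real
  assume "r \<ge> 1" "s \<ge> 1"
  define u v where "u = sqrt r" and "v = sqrt s"
  have u: "u \<ge> 1" and v: "v \<ge> 1" using \<open>r \<ge> 1\<close> \<open>s \<ge> 1\<close> by (auto simp: u_def v_def)
  have "1 - 1 / w \<le> w - 1" if "w \<ge> 1" for w :: real
    using that mult_nonneg_nonneg[of "w - 1" "w - 1"] by (simp add: field_simps)
  then have "(1 - 1 / u) * (1 - 1 / v) \<le> (u - 1) * (v - 1)"
    using u v by (intro mult_mono) auto
  then have "(u - 1 / u) + (v - 1 / v) \<le> u * v - 1 / (u * v)"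
    using u v by (simp add: algebra_simps)
  moreover have "r * s \<ge> 1" using \<open>r \<ge> 1\<close> \<open>s \<ge> 1\<close> mult_mono[of 1 r 1 s] by simp
  ultimately show "sqrt (excess r) + sqrt (excess s) \<le> sqrt (excess (r * s))"
    using \<open>r \<ge> 1\<close> \<open>s \<ge> 1\<close> by (simp add: sqrt_excess u_def v_def real_sqrt_mult)
qed (simp add: excess_def)

lemma loss_inverse: "loss (1 / r) = loss r"
  unfolding loss_def excess_def by (simp add: add.commute)

lemma mult_superadditive_loss: "mult_superadditive loss"
  unfolding mult_superadditive_def
proof (intro conjI allI impI)
  fix r s :: real
  assume "r \<ge> 1" "s \<ge> 1"
  then have "excess r + excess s \<le> excess (r * s)"
      "sqrt (excess r) + sqrt (excess s) \<le> sqrt (excess (r * s))"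
    using mult_superadditive_excess mult_superadditive_sqrt_excess
    by (auto simp: mult_superadditive_def)
  then show "loss r + loss s \<le> loss (r * s)" unfolding loss_def by argo
qed (simp add: loss_def excess_def)

lemma mult_superadditive_sum_list_le:
  assumes g: "mult_superadditive g" and "\<And>x. x \<in> set xs \<Longrightarrow> x \<ge> 1"
  shows "(\<Sum>x\<leftarrow>xs. g x) \<le> g (prod_list xs)"
  using assms(2)
proof (induction xs)
  case Nil
  then show ?case using g by (simp add: mult_superadditive_def)
next
  case (Cons x xs)
  have "x \<ge> 1" "prod_list xs \<ge> 1" using Cons.prems by (auto intro: prod_list_ge1)
  then have "g x + g (prod_list xs) \<le> g (x * prod_list xs)"
    using g by (auto simp: mult_superadditive_def)
  moreover have "(\<Sum>x\<leftarrow>xs. g x) \<le> g (prod_list xs)" using Cons by auto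
  ultimately show ?case by simp
qed

lemma mult_superadditive_sum_list_le_max:
  assumes g: "mult_superadditive g" "\<And>r. g (1 / r) = g r"
    and pos: "\<And>x. x \<in> set xs \<Longrightarrow> x > 0" and prod: "prod_list xs = 1"
  shows "(\<Sum>x\<leftarrow>xs. g x) \<le> 2 * g (\<Prod>x\<leftarrow>xs. max 1 x)"
proof -
  have "g 1 = 0" using g(1) by (simp add: mult_superadditive_def)
  then have split: "g x = g (max 1 x) + g (max 1 (1 / x))" if "x > 0" for x
    using that g(2) by (cases "x \<ge> 1") (auto simp: max_def)
  have "(\<Sum>x\<leftarrow>xs. g x) = (\<Sum>x\<leftarrow>xs. g (max 1 x) + g (max 1 (1 / x)))"
    by (intro arg_cong[where f = sum_list] map_cong[OF refl] split pos)
  also have "\<dots> = (\<Sum>x\<leftarrow>map (max 1) xs. g x) + (\<Sum>x\<leftarrow>map (\<lambda>x. max 1 (1 / x)) xs. g x)"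
    by (simp add: sum_list_addf o_def)
  also have "\<dots> \<le> g (\<Prod>x\<leftarrow>xs. max 1 x) + g (\<Prod>x\<leftarrow>xs. max 1 (1 / x))"
    by (intro add_mono mult_superadditive_sum_list_le g(1)) auto
  also have "(\<Prod>x\<leftarrow>xs. max 1 (1 / x)) = (\<Prod>x\<leftarrow>xs. max 1 x)"
  proof -
    have "(\<Prod>x\<leftarrow>xs. max 1 (1 / x)) * prod_list xs = (\<Prod>x\<leftarrow>xs. max 1 x)"
      using pos
    proof (induction xs)
      case (Cons x xs)
      have "max 1 (1 / x) * x = max 1 x"
        using Cons.prems[of x] by (auto simp: max_def field_simps)
      moreover have "(\<Prod>x\<leftarrow>xs. max 1 (1 / x)) * prod_list xs = (\<Prod>x\<leftarrow>xs. max 1 x)"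
        using Cons by simp
      ultimately have "(max 1 (1 / x) * x) * ((\<Prod>x\<leftarrow>xs. max 1 (1 / x)) * prod_list xs)
          = max 1 x * (\<Prod>x\<leftarrow>xs. max 1 x)" by (simp only:)
      then show ?case by (simp only: list.map prod_list.Cons mult_ac)
    qed simp
    then show ?thesis using prod by simp
  qed
  finally show ?thesis by simp
qed

lemma loss_mono:
  assumes "1 \<le> r" "r \<le> s"
  shows "loss r \<le> loss s"
proof -
  have "s / r \<ge> 1" using assms by simp
  then have "loss r + loss (s / r) \<le> loss (r * (s / r))"
    using mult_superadditive_loss assms(1) unfolding mult_superadditive_def by blast
  moreover have "loss (s / r) \<ge> 0" using assms by (simp add: loss_def excess_nonneg)
  ultimately show ?thesis using assms by simp
qed

lemma ln_prod_list:
  fixes h :: "'a \<Rightarrow> real"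
  assumes "\<And>x. x \<in> set xs \<Longrightarrow> h x > 0"
  shows "ln (\<Prod>x\<leftarrow>xs. h x) = (\<Sum>x\<leftarrow>xs. ln (h x))"
  using assms
proof (induction xs)
  case (Cons x xs)
  have "\<forall>x\<in>set xs. h x > 0" using Cons.prems by simp
  then have "(\<Prod>x\<leftarrow>xs. h x) > 0" by (induction xs) auto
  then show ?case using Cons by (simp add: ln_mult_pos)
qed simp

lemma sum_list_ln_quotient_nonneg:
  fixes h k :: "'a \<Rightarrow> real"
  assumes "\<And>x. x \<in> set xs \<Longrightarrow> h x > 0" "\<And>x. x \<in> set xs \<Longrightarrow> k x > 0"
    and "(\<Prod>x\<leftarrow>xs. h x) \<ge> 1" "(\<Prod>x\<leftarrow>xs. k x) = 1"
  shows "(\<Sum>x\<leftarrow>xs. ln ((h x)\<^sup>2 / k x ^ n)) \<ge> 0"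
proof -
  have "ln ((h x)\<^sup>2 / k x ^ n) = 2 * ln (h x) - n * ln (k x)" if "x \<in> set xs" for x
    using assms(1,2)[OF that] by (simp add: ln_div ln_realpow)
  then have "(\<Sum>x\<leftarrow>xs. ln ((h x)\<^sup>2 / k x ^ n)) = (\<Sum>x\<leftarrow>xs. 2 * ln (h x) - n * ln (k x))"
    by (intro arg_cong[where f = sum_list] map_cong refl)
  also have "\<dots> = 2 * ln (\<Prod>x\<leftarrow>xs. h x) - n * ln (\<Prod>x\<leftarrow>xs. k x)"
    using assms(1,2) by (simp add: sum_list_subtractf sum_list_const_mult ln_prod_list)
  finally show ?thesis using assms(3,4) by simp
qed

lemma Re_sum_list_le:
  fixes zs :: "complex list"
  assumes inv: "mset (map inverse zs) = mset zs" and norm: "(\<Prod>z\<leftarrow>zs. cmod z) = 1"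
    and Phi1: "(\<Prod>z\<leftarrow>zs. cmod (1 - z)) \<ge> 1" and Phi6: "(\<Prod>z\<leftarrow>zs. cmod (z\<^sup>2 - z + 1)) \<ge> 1"
  shows "Re (sum_list zs) \<le> 543/2000 * length zs + loss (\<Prod>z\<leftarrow>zs. max 1 (cmod z))"
proof -
  have "h z \<noteq> 0" if "(\<Prod>z\<leftarrow>zs. h z) \<ge> (1 :: real)" "z \<in> set zs" for h z
    using that prod_list_zero_iff[of "map h zs"] by (metis image_eqI list.set_map not_one_le_zero)
  from this[of cmod] this[OF Phi1] this[OF Phi6]
  have nonzero: "z \<noteq> 0" "z \<noteq> 1" "z\<^sup>2 - z + 1 \<noteq> 0" if "z \<in> set zs" for z
    using that norm by auto
  have "(\<Sum>z\<leftarrow>zs. Re z + Re (1 / z) + 37/50 * ln ((cmod (1 - z))\<^sup>2 / cmod z)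
          + 2/5 * ln ((cmod (z\<^sup>2 - z + 1))\<^sup>2 / (cmod z)\<^sup>2))
      \<le> (\<Sum>z\<leftarrow>zs. 543/1000 + loss (cmod z))"
    by (intro sum_list_mono auxiliary_inequality nonzero)
  then have "(\<Sum>z\<leftarrow>zs. Re z) + (\<Sum>z\<leftarrow>zs. Re (1 / z))
      + 37/50 * (\<Sum>z\<leftarrow>zs. ln ((cmod (1 - z))\<^sup>2 / cmod z))
      + 2/5 * (\<Sum>z\<leftarrow>zs. ln ((cmod (z\<^sup>2 - z + 1))\<^sup>2 / (cmod z)\<^sup>2))
      \<le> length zs * (543/1000) + (\<Sum>z\<leftarrow>zs. loss (cmod z))"
    by (simp only: sum_list_addf sum_list_const_mult sum_list_triv)
  moreover have "(\<Sum>z\<leftarrow>map inverse zs. Re z) = (\<Sum>z\<leftarrow>zs. Re z)"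
    using inv by (metis mset_map sum_mset_sum_list)
  then have "(\<Sum>z\<leftarrow>zs. Re (1 / z)) = (\<Sum>z\<leftarrow>zs. Re z)" by (simp add: o_def inverse_eq_divide)
  moreover have "(\<Sum>z\<leftarrow>zs. ln ((cmod (1 - z))\<^sup>2 / cmod z)) \<ge> 0"
    using sum_list_ln_quotient_nonneg[of zs "\<lambda>z. cmod (1 - z)" cmod 1] nonzero norm Phi1 by simp
  moreover have "(\<Sum>z\<leftarrow>zs. ln ((cmod (z\<^sup>2 - z + 1))\<^sup>2 / (cmod z)\<^sup>2)) \<ge> 0"
    using nonzero norm Phi6 by (intro sum_list_ln_quotient_nonneg) auto
  moreover have "(\<Sum>z\<leftarrow>zs. loss (cmod z)) \<le> 2 * loss (\<Prod>z\<leftarrow>zs. max 1 (cmod z))"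
  proof -
    have "(\<Sum>r\<leftarrow>map cmod zs. loss r) \<le> 2 * loss (\<Prod>r\<leftarrow>map cmod zs. max 1 r)"
      using nonzero(1) norm
      by (intro mult_superadditive_sum_list_le_max mult_superadditive_loss loss_inverse) auto
    then show ?thesis by (simp add: o_def)
  qed
  moreover have "Re (sum_list zs) = (\<Sum>z\<leftarrow>zs. Re z)" by (induction zs) auto
  ultimately show ?thesis by argo
qed

lemma prod_uminus_roots_reciprocal:
  assumes "monic q" "reflect_poly q = q"
  shows "(\<Prod>\<alpha>\<leftarrow>complex_roots_int q. - \<alpha>) = 1"
proof -
  have "coeff q 0 = 1" using assms by (metis coeff_0_reflect_poly)
  moreover have "poly (of_int_poly q) 0 = (\<Prod>\<alpha>\<leftarrow>complex_roots_int q. - \<alpha>)"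
    unfolding of_int_poly_eq_prod_roots[OF assms(1)] by (simp add: poly_prod_list o_def)
  ultimately show ?thesis by (simp add: poly_0_coeff_0)
qed

lemma prod_norm_roots_reciprocal:
  assumes "monic q" "reflect_poly q = q"
  shows "(\<Prod>\<alpha>\<leftarrow>complex_roots_int q. cmod \<alpha>) = 1"
proof -
  have "(\<Prod>\<alpha>\<leftarrow>complex_roots_int q. cmod \<alpha>) = cmod (\<Prod>\<alpha>\<leftarrow>complex_roots_int q. - \<alpha>)" by simp
  also have "\<dots> = 1" unfolding prod_uminus_roots_reciprocal[OF assms] by simp
  finally show ?thesis .
qed

lemma prod_linear_inverse:
  fixes as :: "'a :: field list"
  assumes "0 \<notin> set as"
  shows "(\<Prod>\<alpha>\<leftarrow>as. [:1, - \<alpha>:]) = Polynomial.smult (\<Prod>\<alpha>\<leftarrow>as. - \<alpha>) (\<Prod>\<alpha>\<leftarrow>map inverse as. [:- \<alpha>, 1:])"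
  using assms
proof (induction as)
  case (Cons \<beta> as)
  then have linear: "[:1, - \<beta>:] = Polynomial.smult (- \<beta>) [:- inverse \<beta>, 1:]" by simp
  have IH: "(\<Prod>\<alpha>\<leftarrow>as. [:1, - \<alpha>:])
      = Polynomial.smult (\<Prod>\<alpha>\<leftarrow>as. - \<alpha>) (\<Prod>\<alpha>\<leftarrow>map inverse as. [:- \<alpha>, 1:])"
    using Cons by simp
  show ?case
    by (simp only: list.map prod_list.Cons linear IH mult_smult_left mult_smult_right smult_smult
        mult.commute[of _ "- \<beta>"])
qed simp

lemma mset_map_inverse_roots:
  assumes "monic q" "reflect_poly q = q"
  shows "mset (map inverse (complex_roots_int q)) = mset (complex_roots_int q)"
proof (rule reconstruct_poly_monic_defines_mset)
  define as where "as = complex_roots_int q"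
  have prod: "(\<Prod>\<alpha>\<leftarrow>as. - \<alpha>) = 1"
    using prod_uminus_roots_reciprocal[OF assms] by (simp add: as_def)
  then have "0 \<notin> set as"
    by (metis image_eqI list.set_map minus_zero prod_list_zero_iff zero_neq_one)
  then have "(\<Prod>\<alpha>\<leftarrow>as. [:1, - \<alpha>:]) = (\<Prod>\<alpha>\<leftarrow>map inverse as. [:- \<alpha>, 1:])"
    by (rule prod_linear_inverse[of as, unfolded prod smult_1_left])
  moreover have "of_int_poly q = reflect_poly (of_int_poly q :: complex poly)"
    using assms(2) by (simp add: reflect_of_int_poly)
  ultimately show "(\<Prod>\<alpha>\<leftarrow>map inverse (complex_roots_int q). [:- \<alpha>, 1:]) = (\<Prod>\<alpha>\<leftarrow>complex_roots_int q. [:- \<alpha>, 1:])"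
    unfolding of_int_poly_eq_prod_roots[OF assms(1)] reflect_poly_prod_linear as_def by metis
qed

definition root_of_unity_free :: "int poly \<Rightarrow> bool" where
  "root_of_unity_free q \<longleftrightarrow> (\<forall>\<alpha>::complex. \<forall>n\<ge>1. poly (of_int_poly q) \<alpha> = 0 \<longrightarrow> \<alpha> ^ n \<noteq> 1)"

lemma signed_power_pow_6_neq_1:
  fixes \<alpha> :: complex and \<sigma> :: int
  assumes "root_of_unity_free q" "poly (of_int_poly q) \<alpha> = 0" "k \<ge> 1" "\<sigma> = 1 \<or> \<sigma> = -1"
  shows "(of_int \<sigma> * \<alpha> ^ k) ^ 6 \<noteq> 1"
proof -
  have "(of_int \<sigma> * \<alpha> ^ k) ^ 6 = \<alpha> ^ (6 * k)"
    using assms(4) by (auto simp: power_mult_distrib mult.commute simp flip: power_mult)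
  then show ?thesis using assms(1-3) by (simp add: root_of_unity_free_def)
qed

lemma norm_prod_Phi1_signed_powers_ge_1:
  fixes \<sigma> :: int
  assumes q: "monic q" "root_of_unity_free q" and k: "k \<ge> 1" and \<sigma>: "\<sigma> = 1 \<or> \<sigma> = -1"
  shows "(\<Prod>\<alpha>\<leftarrow>complex_roots_int q. cmod (1 - of_int \<sigma> * \<alpha> ^ k)) \<ge> 1"
proof -
  have eval: "poly (of_int_poly (1 - monom \<sigma> k)) \<alpha> = 1 - of_int \<sigma> * \<alpha> ^ k" for \<alpha> :: complex
    by (simp add: poly_monom of_int_poly_hom.hom_minus of_int_hom.map_poly_hom_monom)
  have "q \<noteq> 0" using q(1) by auto
  have "1 - of_int \<sigma> * \<alpha> ^ k \<noteq> 0" if "\<alpha> \<in> set (complex_roots_int q)" for \<alpha>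
    using that signed_power_pow_6_neq_1[OF q(2) _ k \<sigma>, of \<alpha>] \<open>q \<noteq> 0\<close>
    by (auto simp: set_complex_roots_int)
  then show ?thesis
    using norm_prod_poly_roots_ge_1[OF q(1), of "1 - monom \<sigma> k", unfolded eval] by blast
qed

lemma norm_prod_Phi6_signed_powers_ge_1:
  fixes \<sigma> :: int
  assumes q: "monic q" "root_of_unity_free q" and k: "k \<ge> 1" and \<sigma>: "\<sigma> = 1 \<or> \<sigma> = -1"
  shows "(\<Prod>\<alpha>\<leftarrow>complex_roots_int q. cmod ((of_int \<sigma> * \<alpha> ^ k)\<^sup>2 - of_int \<sigma> * \<alpha> ^ k + 1)) \<ge> 1"
proof -
  have eval: "poly (of_int_poly (monom 1 (2 * k) - monom \<sigma> k + 1)) \<alpha>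
      = (of_int \<sigma> * \<alpha> ^ k)\<^sup>2 - of_int \<sigma> * \<alpha> ^ k + 1" for \<alpha> :: complex
    using \<sigma> by (auto simp: poly_monom of_int_poly_hom.hom_minus of_int_poly_hom.hom_add
        of_int_hom.map_poly_hom_monom power_mult mult.commute[of 2])
  have factor: "w ^ 6 - 1 = (w\<^sup>2 - w + 1) * ((w + 1) * (w ^ 3 - 1))" for w :: complex
    by (simp add: algebra_simps eval_nat_numeral)
  have "q \<noteq> 0" using q(1) by auto
  have "(of_int \<sigma> * \<alpha> ^ k)\<^sup>2 - of_int \<sigma> * \<alpha> ^ k + 1 \<noteq> 0" if "\<alpha> \<in> set (complex_roots_int q)" for \<alpha>
    using that signed_power_pow_6_neq_1[OF q(2) _ k \<sigma>, of \<alpha>] factor[of "of_int \<sigma> * \<alpha> ^ k"] \<open>q \<noteq> 0\<close>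
    by (auto simp: set_complex_roots_int)
  then show ?thesis
    using norm_prod_poly_roots_ge_1[OF q(1), of "monom 1 (2 * k) - monom \<sigma> k + 1", unfolded eval]
    by blast
qed

lemma signed_power_sum_le:
  fixes \<sigma> :: int
  assumes q: "monic q" "reflect_poly q = q" "root_of_unity_free q"
    and k: "k \<ge> 1" and \<sigma>: "\<sigma> = 1 \<or> \<sigma> = -1"
  shows "of_int \<sigma> * Re (power_sum (complex_roots_int q) k)
    \<le> 543/2000 * degree q + loss (mahler_measure q ^ k)"
proof -
  define as where "as = complex_roots_int q"
  define z :: "complex \<Rightarrow> complex" where "z = (\<lambda>\<alpha>. of_int \<sigma> * \<alpha> ^ k)"
  define zs where "zs = map z as"
  have "inverse (z \<alpha>) = z (inverse \<alpha>)" for \<alpha> using \<sigma> by (auto simp: z_def power_inverse)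
  then have "map inverse zs = map z (map inverse as)" by (simp add: zs_def)
  then have inv: "mset (map inverse zs) = mset zs"
    by (metis as_def mset_map mset_map_inverse_roots[OF q(1,2)] zs_def)
  have norm_z: "cmod (z \<alpha>) = cmod \<alpha> ^ k" for \<alpha> using \<sigma> by (auto simp: z_def norm_mult norm_power)
  have "(\<Prod>w\<leftarrow>zs. cmod w) = (\<Prod>\<alpha>\<leftarrow>as. cmod \<alpha>) ^ k"
    by (simp add: zs_def o_def norm_z prod_list_power)
  then have norm: "(\<Prod>w\<leftarrow>zs. cmod w) = 1" by (simp add: as_def prod_norm_roots_reciprocal[OF q(1,2)])
  have Phi1: "(\<Prod>w\<leftarrow>zs. cmod (1 - w)) \<ge> 1"
    using norm_prod_Phi1_signed_powers_ge_1[OF q(1,3) k \<sigma>] by (simp add: zs_def z_def as_def o_def)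
  have Phi6: "(\<Prod>w\<leftarrow>zs. cmod (w\<^sup>2 - w + 1)) \<ge> 1"
    using norm_prod_Phi6_signed_powers_ge_1[OF q(1,3) k \<sigma>] by (simp add: zs_def z_def as_def o_def)
  have "(\<Prod>w\<leftarrow>zs. max 1 (cmod w)) = mahler_measure q ^ k"
    unfolding mahler_measure_monic_eq[OF q(1)] as_def[symmetric]
    by (simp add: zs_def o_def norm_z max_1_power prod_list_power)
  moreover have "sum_list zs = of_int \<sigma> * power_sum as k"
    by (simp add: zs_def z_def power_sum_def sum_list_const_mult)
  then have "Re (sum_list zs) = of_int \<sigma> * Re (power_sum as k)" using \<sigma> by auto
  moreover have "length zs = degree q" by (simp add: zs_def as_def complex_roots_int(2))
  ultimately show ?thesis
    using Re_sum_list_le[OF inv norm Phi1 Phi6] by (simp add: as_def)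
qed

lemma abs_power_sum_le:
  assumes "monic q" "reflect_poly q = q" "root_of_unity_free q" "k \<ge> 1"
  shows "\<bar>Re (power_sum (complex_roots_int q) k)\<bar> \<le> 543/2000 * degree q + loss (mahler_measure q ^ k)"
  using signed_power_sum_le[OF assms, of 1] signed_power_sum_le[OF assms, of "-1"] by simp

section \<open>The search\<close>

text \<open>These functions are evaluated by rewriting, which is strict except in the branches of \<open>if\<close>
  and \<open>case\<close>; hence the conditionals in place of conjunctions and disjunctions.\<close>

fun dot :: "int list \<Rightarrow> int list \<Rightarrow> int" where
  "dot (x # xs) (y # ys) = x * y + dot xs ys"
| "dot xs ys = 0"

text \<open>Division by the monic polynomial with coefficient list \<open>1 # p\<close>; lists start with the
  leading coefficient.\<close>

fun subtract_multiple :: "int list \<Rightarrow> int \<Rightarrow> int list \<Rightarrow> int list option" where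
  "subtract_multiple xs c [] = Some xs"
| "subtract_multiple [] c (p # ps) = None"
| "subtract_multiple (x # xs) c (p # ps) = map_option ((#) (x - c * p)) (subtract_multiple xs c ps)"

lemma length_subtract_multiple:
  "subtract_multiple xs c ps = Some ys \<Longrightarrow> length ys = length xs"
  by (induction xs c ps arbitrary: ys rule: subtract_multiple.induct) auto

function list_divides :: "int list \<Rightarrow> int list \<Rightarrow> bool" where
  "list_divides p [] = True"
| "list_divides p (x # xs) = (case subtract_multiple xs x p of
     None \<Rightarrow> dropWhile ((=) 0) (x # xs) = []
   | Some ys \<Rightarrow> list_divides p ys)"
  by pat_completeness auto
termination
  by (relation "Wellfounded.measure (length \<circ> snd)") (auto dest: length_subtract_multiple)

primrec has_divisor :: "int list list \<Rightarrow> int list \<Rightarrow> bool" where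
  "has_divisor [] q = False"
| "has_divisor (p # ps) q = (if list_divides p q then True else has_divisor ps q)"

fun list_add :: "int list \<Rightarrow> int list \<Rightarrow> int list" where
  "list_add [] ys = ys"
| "list_add xs [] = xs"
| "list_add (x # xs) (y # ys) = (x + y) # list_add xs ys"

primrec list_mult :: "int list \<Rightarrow> int list \<Rightarrow> int list" where
  "list_mult [] ys = []"
| "list_mult (x # xs) ys = list_add (map ((*) x) ys) (0 # list_mult xs ys)"

definition list_square :: "int list \<Rightarrow> int list" where
  "list_square xs = list_mult xs xs"

definition graeffe_step :: "int list \<Rightarrow> int list" where
  "graeffe_step xs = list_add (list_square (drop_half xs)) (0 # map uminus (list_square (drop_half (tl xs))))"

fun exceeds :: "int \<Rightarrow> int list \<Rightarrow> int list \<Rightarrow> bool" where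
  "exceeds N (b # bs) (y # ys) = (if \<bar>y\<bar> > b * N then True else exceeds N bs ys)"
| "exceeds N bs ys = False"

primrec graeffe_exceeds :: "int list \<Rightarrow> int list \<Rightarrow> int list \<Rightarrow> bool" where
  "graeffe_exceeds [] bin xs = False"
| "graeffe_exceeds (N # Ns) bin xs = (if exceeds N bin xs then True else graeffe_exceeds Ns bin (graeffe_step xs))"

text \<open>A candidate polynomial is given by \<open>cs\<close>, its coefficients after the leading one, and
  \<open>ss\<close>, its power sums so far in reversed order.\<close>

primrec all_extensions :: "(int list \<Rightarrow> int list \<Rightarrow> bool) \<Rightarrow> int \<Rightarrow> int \<Rightarrow> int list \<Rightarrow> int list \<Rightarrow> int list \<Rightarrow> bool" where
  "all_extensions test n b cs ss [] = True"
| "all_extensions test n b cs ss (x # xs) =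
     (if test (cs @ [x]) ((b - n * x) # ss) then all_extensions test n b cs ss xs else False)"

fun search_step :: "(int list \<Rightarrow> int list \<Rightarrow> bool) \<Rightarrow> int \<times> int \<Rightarrow> int \<Rightarrow> int list \<Rightarrow> int list \<Rightarrow> bool" where
  "search_step test (n, B) b cs ss = all_extensions test n b cs ss [- ((B - b) div n)..(b + B) div n]"

primrec search :: "(int \<times> int) list \<Rightarrow> (int list \<Rightarrow> int list \<Rightarrow> bool) \<Rightarrow> int list \<Rightarrow> int list \<Rightarrow> bool" where
  "search [] test cs ss = test cs ss"
| "search (nB # bs) test cs ss = search_step (search bs test) nB (- dot cs ss) cs ss"

definition within_bound :: "(int list \<Rightarrow> bool) \<Rightarrow> int \<Rightarrow> int \<Rightarrow> int list \<Rightarrow> bool" where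
  "within_bound test B s ss = (if \<bar>s\<bar> > B then True else test (s # ss))"

primrec extend_sums :: "(int \<times> int) list \<Rightarrow> (int list \<Rightarrow> bool) \<Rightarrow> int list \<Rightarrow> int list \<Rightarrow> int list \<Rightarrow> bool" where
  "extend_sums [] test cs rest ss = test cs"
| "extend_sums (nB # bs) test cs rest ss =
     within_bound (extend_sums bs test cs (tl rest)) (snd nB) (- (dot cs ss + fst nB * hd rest)) ss"

definition mirrored :: "int list \<Rightarrow> int list" where
  "mirrored cs = tl (rev cs) @ [1]"

definition test_palindrome :: "(int \<times> int) list \<Rightarrow> (int list \<Rightarrow> bool) \<Rightarrow> int list \<Rightarrow> int list \<Rightarrow> bool" where
  "test_palindrome bs test cs ss =
     extend_sums bs test (cs @ mirrored cs) (mirrored cs @ map (\<lambda>_. 0) bs) ss"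

text \<open>An entry \<open>(n, p)\<close> stands for the \<open>n\<close>-th cyclotomic polynomial, with coefficients \<open>1 # p\<close>. The two
  lists together contain those that occur among the leaves of the search.\<close>

definition cyclotomics :: "(nat \<times> int list) list" where
  "cyclotomics =
  [(1, [-1]),
   (4, [0, 1]),
   (6, [-1, 1]),
   (3, [1, 1]),
   (2, [1]),
   (10, [-1, 1, -1, 1]),
   (5, [1, 1, 1, 1]),
   (8, [0, 0, 0, 1]),
   (12, [0, -1, 0, 1]),
   (14, [-1, 1, -1, 1, -1, 1]),
   (7, [1, 1, 1, 1, 1, 1]),
   (9, [0, 0, 1, 0, 0, 1]),
   (18, [0, 0, -1, 0, 0, 1])]"

definition more_cyclotomics :: "(nat \<times> int list) list" where
  "more_cyclotomics =
  [(15, [-1, 0, 1, -1, 1, 0, -1, 1]),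
   (16, [0, 0, 0, 0, 0, 0, 0, 1]),
   (20, [0, -1, 0, 1, 0, -1, 0, 1]),
   (30, [1, 0, -1, -1, -1, 0, 1, 1]),
   (11, [1, 1, 1, 1, 1, 1, 1, 1, 1, 1]),
   (22, [-1, 1, -1, 1, -1, 1, -1, 1, -1, 1]),
   (13, [1, 1, 1, 1, 1, 1, 1, 1, 1, 1, 1, 1]),
   (26, [-1, 1, -1, 1, -1, 1, -1, 1, -1, 1, -1, 1]),
   (21, [-1, 0, 1, -1, 0, 1, 0, -1, 1, 0, -1, 1]),
   (42, [1, 0, -1, -1, 0, 1, 0, -1, -1, 0, 1, 1]),
   (28, [0, -1, 0, 1, 0, -1, 0, 1, 0, -1, 0, 1]),
   (36, [0, 0, 0, 0, 0, -1, 0, 0, 0, 0, 0, 1]),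
   (17, [1, 1, 1, 1, 1, 1, 1, 1, 1, 1, 1, 1, 1, 1, 1, 1]),
   (34, [-1, 1, -1, 1, -1, 1, -1, 1, -1, 1, -1, 1, -1, 1, -1, 1]),
   (24, [0, 0, 0, -1, 0, 0, 0, 1]),
   (32, [0, 0, 0, 0, 0, 0, 0, 0, 0, 0, 0, 0, 0, 0, 0, 1]),
   (40, [0, 0, 0, -1, 0, 0, 0, 1, 0, 0, 0, -1, 0, 0, 0, 1]),
   (48, [0, 0, 0, 0, 0, 0, 0, -1, 0, 0, 0, 0, 0, 0, 0, 1]),
   (60, [0, 1, 0, 0, 0, -1, 0, -1, 0, -1, 0, 0, 0, 1, 0, 1])]"

definition lehmer_lists :: "int list list" where
  "lehmer_lists = [[1, 0, -1, -1, -1, -1, -1, 0, 1, 1],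
     [-1, 0, 1, -1, 1, -1, 1, 0, -1, 1]]"

abbreviation forbidden_divisors :: "int list list" where
  "forbidden_divisors \<equiv> map snd cyclotomics @ map snd more_cyclotomics @ lehmer_lists"

definition lehmer_upper :: real where
  "lehmer_upper = 11763/10000"

text \<open>With \<open>\<Lambda>\<close> for \<open>lehmer_upper\<close>, the \<open>k\<close>-th entry is an upper bound for \<open>1000 loss(\<Lambda>\<^sup>k)\<close>, \<open>k \<ge> 1\<close>;
  the entries of \<open>graeffe_bounds\<close> are upper bounds for \<open>\<Lambda>, \<Lambda>\<^sup>2, \<Lambda>\<^sup>4, \<Lambda>\<^sup>8, \<dots>\<close>.\<close>

definition sum_corrections :: "int list" where
  "sum_corrections = [197, 527, 999, 1622, 2408, 3378, 4552, 5960, 7636, 9620, 11962, 14719]"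

definition sum_bound :: "nat \<Rightarrow> nat \<Rightarrow> int" where
  "sum_bound d k = (543 * int d + sum_corrections ! (k - 1)) div 1000"

definition graeffe_bounds :: "int list" where
  "graeffe_bounds = [2, 2, 2, 4, 14, 181, 32600, 1062800000, 1129600000000000000]"

definition binomials :: "nat \<Rightarrow> int list" where
  "binomials d = map (\<lambda>j. int (2 * d choose j)) [0..<Suc d]"

definition reject :: "int list \<Rightarrow> int list \<Rightarrow> bool" where
  "reject bin cs = (if has_divisor (map snd cyclotomics) (1 # cs) then True
     else if graeffe_exceeds graeffe_bounds bin (1 # cs) then True
     else has_divisor (map snd more_cyclotomics @ lehmer_lists) (1 # cs))"

definition search_degree :: "nat \<Rightarrow> bool" where
  "search_degree d = search (map (\<lambda>k. (int k, sum_bound d k)) [1..<Suc d])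
     (test_palindrome (map (\<lambda>k. (int k, sum_bound d k)) [Suc d..<Suc 12])
       (reject (binomials d))) [] []"

definition Poly_rev :: "int list \<Rightarrow> int poly" where
  "Poly_rev xs = Poly (rev xs)"

lemma Poly_rev_Nil: "Poly_rev [] = 0"
  by (simp add: Poly_rev_def)

lemma Poly_rev_Cons: "Poly_rev (x # xs) = monom x (length xs) + Poly_rev xs"
  by (simp add: Poly_rev_def Poly_snoc add.commute)

lemma subtract_multiple_Poly_rev:
  assumes "subtract_multiple xs c ps = Some ys"
  shows "length ps \<le> length xs"
    and "Poly_rev ys = Poly_rev xs - monom c (length xs - length ps) * Poly_rev ps"
proof -
  have "length ps \<le> length xs \<and> Poly_rev ys = Poly_rev xs - monom c (length xs - length ps) * Poly_rev ps"
    using assms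
  proof (induction xs c ps arbitrary: ys rule: subtract_multiple.induct)
    case (1 xs c)
    then show ?case by (simp add: Poly_rev_Nil)
  next
    case (3 x xs c p ps)
    from "3.prems" obtain zs where zs: "subtract_multiple xs c ps = Some zs" "ys = (x - c * p) # zs"
      by auto
    note IH = "3.IH"[OF zs(1)]
    have "monom c (length xs - length ps) * monom p (length ps) = monom (c * p) (length xs)"
      using IH by (simp add: mult_monom)
    then show ?case using IH zs(2) length_subtract_multiple[OF zs(1)]
      by (simp add: Poly_rev_Cons diff_monom[symmetric] algebra_simps)
  qed simp
  then show "length ps \<le> length xs"
    and "Poly_rev ys = Poly_rev xs - monom c (length xs - length ps) * Poly_rev ps" by auto
qed

lemma Poly_rev_eq_0_if_dropWhile_Nil: "dropWhile ((=) 0) xs = [] \<Longrightarrow> Poly_rev xs = 0"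
  by (induction xs) (auto simp: Poly_rev_Nil Poly_rev_Cons split: if_splits)

lemma list_divides_imp_dvd: "list_divides p q \<Longrightarrow> Poly_rev (1 # p) dvd Poly_rev q"
proof (induction p q rule: list_divides.induct)
  case (2 p x xs)
  show ?case
  proof (cases "subtract_multiple xs x p")
    case None
    with "2.prems" have "dropWhile ((=) 0) (x # xs) = []" by simp
    from Poly_rev_eq_0_if_dropWhile_Nil[OF this] show ?thesis by simp
  next
    case (Some ys)
    note subtract = subtract_multiple_Poly_rev[OF Some]
    have "monom x (length xs - length p) * monom 1 (length p) = monom x (length xs)"
      using subtract(1) by (simp add: mult_monom)
    then have "Poly_rev (x # xs) = Poly_rev ys + monom x (length xs - length p) * Poly_rev (1 # p)"
      using subtract(2) by (simp add: Poly_rev_Cons algebra_simps)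
    moreover have "Poly_rev (1 # p) dvd Poly_rev ys" using 2 Some by simp
    ultimately show ?thesis by simp
  qed
qed (simp add: Poly_rev_Nil)

lemma has_divisor_imp_dvd:
  "has_divisor ps q \<Longrightarrow> \<exists>p\<in>set ps. Poly_rev (1 # p) dvd Poly_rev q"
  by (induction ps) (auto split: if_splits dest: list_divides_imp_dvd)

lemma Poly_list_add: "Poly (list_add xs ys) = Poly xs + Poly ys"
  by (induction xs ys rule: list_add.induct) auto

lemma Poly_map_mult: "Poly (map ((*) c) xs) = Polynomial.smult c (Poly xs)"
  by (induction xs) auto

lemma Poly_map_uminus: "Poly (map uminus xs) = - Poly xs"
  by (induction xs) auto

lemma Poly_list_mult: "Poly (list_mult xs ys) = Poly xs * Poly ys"
  by (induction xs) (auto simp: Poly_list_add Poly_map_mult)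

lemma nth_default_drop_half: "nth_default 0 (drop_half xs) i = nth_default 0 xs (2 * i)"
proof (induction xs arbitrary: i rule: drop_half.induct)
  case (1 x y ys)
  then show ?case by (cases i) simp_all
next
  case ("2_2" x)
  then show ?case by (cases i) simp_all
qed simp

lemma nth_default_tl: "nth_default a (tl xs) i = nth_default a xs (Suc i)"
  by (cases xs) simp_all

lemma Poly_graeffe_step: "Poly (graeffe_step xs) = graeffe_one_step 1 (Poly xs)"
proof -
  obtain g h where gh: "poly_even_odd (Poly xs) = (g, h)" by force
  have "g = Poly (drop_half xs)" "h = Poly (drop_half (tl xs))"
    using poly_even_odd_coeff[OF gh]
    by (auto intro!: poly_eqI simp: coeff_Poly_eq nth_default_drop_half nth_default_tl)
  then show ?thesis
    unfolding graeffe_one_step_code gh graeffe_step_def list_square_def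
    by (simp add: Poly_list_add Poly_list_mult Poly_map_uminus monom_Suc mult.assoc del: Poly_eq_0)
qed

lemma degree_graeffe_poly_impl: "degree (graeffe_poly_impl f m) = degree (f :: int poly)"
proof (cases "f = 0")
  case True
  have "graeffe_poly_impl (0 :: int poly) m = 0" unfolding graeffe_poly_impl_def
    by (induction m) (simp_all add: graeffe_one_step_def poly_square_subst_def)
  then show ?thesis using True by simp
next
  case False
  have "of_int_poly (graeffe_poly_impl f m)
      = graeffe_poly (lead_coeff (of_int_poly f)) (complex_roots_int f) m"
    using graeffe_poly_impl[OF complex_roots_int(1)[symmetric], of f m]
    by (simp add: of_int_hom.graeffe_poly_impl_hom)
  then have "degree (of_int_poly (graeffe_poly_impl f m) :: complex poly) = length (complex_roots_int f)"
    using False by (simp only: graeffe_poly_def degree_smult_eq degree_linear_factors)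
      (simp add: complex_roots_int(2))
  then show ?thesis by (simp add: complex_roots_int(2))
qed

lemma not_exceeds:
  assumes "\<And>j. j < length bs \<Longrightarrow> j < length ys \<Longrightarrow> \<bar>ys ! j\<bar> \<le> bs ! j * N"
  shows "\<not> exceeds N bs ys"
  using assms
proof (induction N bs ys rule: exceeds.induct)
  case (1 N b bs y ys)
  have "\<bar>y\<bar> \<le> b * N" using "1.prems"[of 0] by simp
  moreover have "\<bar>ys ! j\<bar> \<le> bs ! j * N" if "j < length bs" "j < length ys" for j
    using "1.prems"[of "Suc j"] that by simp
  ultimately show ?case using "1.IH" by simp
qed simp_all

lemma abs_coeff_le_if_mahler_measure_le:
  assumes "mahler_measure f \<le> of_int N"
  shows "\<bar>coeff f j\<bar> \<le> int (degree f choose j) * N"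
proof -
  have "real_of_int \<bar>coeff f j\<bar> \<le> real (degree f choose j) * mahler_measure f"
    by (rule Mignotte_bound)
  also have "\<dots> \<le> real (degree f choose j) * of_int N" using assms by (intro mult_left_mono) auto
  finally have "real_of_int \<bar>coeff f j\<bar> \<le> of_int (int (degree f choose j) * N)" by simp
  then show ?thesis by (simp only: of_int_le_iff)
qed

lemma not_graeffe_exceeds:
  assumes even: "even (degree f)" and M: "mahler_measure f \<le> \<Lambda>"
    and bin: "\<And>j. j < length bin \<Longrightarrow> bin ! j = int (degree f choose j)"
    and Ns: "\<And>i. i < length Ns \<Longrightarrow> \<Lambda> ^ 2 ^ (m + i) \<le> of_int (Ns ! i)"
    and xs: "Poly xs = graeffe_poly_impl f m"
  shows "\<not> graeffe_exceeds Ns bin xs"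
  using Ns xs
proof (induction Ns arbitrary: m xs)
  case (Cons N Ns)
  have "mahler_measure (graeffe_poly_impl f m) = mahler_measure f ^ 2 ^ m"
    by (rule graeffe_poly_impl_mahler)
  also have "\<dots> \<le> \<Lambda> ^ 2 ^ m"
    using M mahler_measure_ge_0 by (intro power_mono) auto
  also have "\<dots> \<le> of_int N" using Cons.prems(1)[of 0] by simp
  finally have "\<bar>coeff (Poly xs) j\<bar> \<le> int (degree f choose j) * N" for j
    using abs_coeff_le_if_mahler_measure_le by (metis Cons.prems(2) degree_graeffe_poly_impl)
  then have "\<bar>xs ! j\<bar> \<le> bin ! j * N" if "j < length bin" "j < length xs" for j
    using that bin by (metis coeff_Poly_eq nth_default_nth)
  then have "\<not> exceeds N bin xs" by (rule not_exceeds)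
  moreover have "Poly (graeffe_step xs) = graeffe_poly_impl f (Suc m)"
    unfolding Poly_graeffe_step Cons.prems(2) using even by (simp add: graeffe_poly_impl_def)
  then have "\<not> graeffe_exceeds Ns bin (graeffe_step xs)"
    using Cons.prems(1)[of "Suc _"] by (intro Cons.IH[of "Suc m"]) auto
  ultimately show ?case by simp
qed simp

lemma dot_eq_sum: "dot xs ys = (\<Sum>i<min (length xs) (length ys). xs ! i * ys ! i)"
  by (induction xs ys rule: dot.induct) (simp_all add: sum.lessThan_Suc_shift del: sum.lessThan_Suc)

lemma all_extensionsD:
  assumes "all_extensions test n b cs ss xs" "x \<in> set xs"
  shows "test (cs @ [x]) ((b - n * x) # ss)"
  using assms by (induction xs) (auto split: if_splits)

text \<open>\<open>c n\<close> is the \<open>n\<close>-th coefficient after the leading one and \<open>s n\<close> the \<open>n\<close>-th power sum of the zeros.\<close>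

locale newton_sequences =
  fixes c s B :: "nat \<Rightarrow> int" and D K :: nat
  assumes newton: "n \<ge> 1 \<Longrightarrow> s n = - (int n * c n + (\<Sum>i=1..<n. c i * s (n - i)))"
    and coeff_eq_0: "n > D \<Longrightarrow> c n = 0"
    and sum_bounded: "1 \<le> n \<Longrightarrow> n \<le> K \<Longrightarrow> \<bar>s n\<bar> \<le> B n"
begin

abbreviation coeffs_upto :: "nat \<Rightarrow> nat \<Rightarrow> int list" where
  "coeffs_upto m n \<equiv> map c [m..<n]"

abbreviation bounds_upto :: "nat \<Rightarrow> nat \<Rightarrow> (int \<times> int) list" where
  "bounds_upto m n \<equiv> map (\<lambda>k. (int k, B k)) [m..<n]"

abbreviation sums_below :: "nat \<Rightarrow> int list" where
  "sums_below n \<equiv> rev (map s [1..<n])"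

lemma dot_coeffs_sums:
  assumes "n \<le> m \<or> D < m"
  shows "dot (coeffs_upto 1 m) (sums_below n) = (\<Sum>i=1..<n. c i * s (n - i))"
proof -
  have "dot (coeffs_upto 1 m) (sums_below n) = (\<Sum>i<min (m - 1) (n - 1). c (Suc i) * s (n - Suc i))"
    unfolding dot_eq_sum by (intro sum.cong) (auto simp: rev_nth Suc_diff_Suc)
  also have "\<dots> = (\<Sum>i\<in>{1..<n} \<inter> {..<m}. c i * s (n - i))"
    by (rule sum.reindex_bij_witness[of _ "\<lambda>i. i - 1" Suc]) auto
  also have "\<dots> = (\<Sum>i=1..<n. c i * s (n - i))"
    using assms by (intro sum.mono_neutral_left) (auto intro!: coeff_eq_0)
  finally show ?thesis .
qed

lemma coeff_in_search_range:
  assumes "1 \<le> n" "n \<le> K"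
  defines "b \<equiv> - (\<Sum>i=1..<n. c i * s (n - i))"
  shows "c n \<in> set [- ((B n - b) div int n)..(b + B n) div int n]"
proof -
  have le_div: "x \<le> y div int n" if "int n * x \<le> y" for x y
    using zdiv_mono1[OF that, of "int n"] assms(1) by simp
  have "\<bar>b - int n * c n\<bar> \<le> B n" using newton[of n] sum_bounded[of n] assms by simp
  then have "int n * (- c n) \<le> B n - b" "int n * c n \<le> b + B n" by (simp_all add: abs_le_iff)
  from this[THEN le_div] show ?thesis by simp
qed

lemma search_imp_test:
  assumes "search (bounds_upto n m) test (coeffs_upto 1 n) (sums_below n)"
    and "1 \<le> n" "n \<le> m" "m \<le> Suc K"
  shows "test (coeffs_upto 1 m) (sums_below m)"
  using assms(3,1)
proof (induction n rule: inc_induct)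
  case (step k)
  then have k: "1 \<le> k" "k \<le> K" using assms(2,4) by auto
  define b where "b = - (\<Sum>i=1..<k. c i * s (k - i))"
  have "bounds_upto k m = (int k, B k) # bounds_upto (Suc k) m"
    using step.hyps by (simp add: upt_conv_Cons)
  moreover have "- dot (coeffs_upto 1 k) (sums_below k) = b"
    using dot_coeffs_sums[of k k] by (simp add: b_def)
  ultimately have "all_extensions (search (bounds_upto (Suc k) m) test) (int k) b
      (coeffs_upto 1 k) (sums_below k) [- ((B k - b) div int k)..(b + B k) div int k]"
    using step.prems by simp
  from all_extensionsD[OF this coeff_in_search_range[OF k, folded b_def]]
  have "search (bounds_upto (Suc k) m) test (coeffs_upto 1 k @ [c k]) ((b - int k * c k) # sums_below k)" .
  moreover have "b - int k * c k = s k" using newton[of k] k by (simp add: b_def)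
  ultimately show ?case using k by (intro step.IH) simp
qed simp

lemma extend_sums_imp_test:
  assumes "extend_sums (bounds_upto n (Suc K)) test (coeffs_upto 1 (Suc D)) (coeffs_upto n m) (sums_below n)"
    and "1 \<le> n" "n \<le> Suc K" "Suc K \<le> m"
  shows "test (coeffs_upto 1 (Suc D))"
  using assms(3,1)
proof (induction n rule: inc_induct)
  case (step k)
  then have k: "1 \<le> k" "k \<le> K" using assms(2) by auto
  have "bounds_upto k (Suc K) = (int k, B k) # bounds_upto (Suc k) (Suc K)"
    and coeffs: "coeffs_upto k m = c k # coeffs_upto (Suc k) m"
    using k assms(4) by (simp_all add: upt_conv_Cons del: upt_Suc)
  moreover have "- (dot (coeffs_upto 1 (Suc D)) (sums_below k) + int k * c k) = s k"
    using dot_coeffs_sums[of k "Suc D"] newton[of k] k by simp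
  ultimately have "within_bound (extend_sums (bounds_upto (Suc k) (Suc K)) test (coeffs_upto 1 (Suc D))
      (coeffs_upto (Suc k) m)) (B k) (s k) (sums_below k)"
    using step.prems by (simp del: upt_Suc)
  moreover have "sums_below (Suc k) = s k # sums_below k" using k by simp
  ultimately show ?case
    using sum_bounded[OF k] by (intro step.IH) (simp add: within_bound_def del: upt_Suc)
qed simp

end

lemma mirrored_map_upt:
  assumes "\<And>i. i \<le> 2 * d \<Longrightarrow> c (2 * d - i) = c i" "c 0 = 1" "d \<ge> 1"
  shows "mirrored (map c [1..<Suc d]) = map c [Suc d..<Suc (2 * d)]"
proof (rule nth_equalityI)
  fix i
  assume "i < length (mirrored (map c [1..<Suc d]))"
  then have i: "i < d" using assms(3) by (simp add: mirrored_def del: upt_Suc)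
  have "c (Suc d + i) = c (d - 1 - i)" using i assms(1)[of "d - 1 - i"] by (simp add: mult_2)
  then show "mirrored (map c [1..<Suc d]) ! i = map c [Suc d..<Suc (2 * d)] ! i"
    using i assms(2)
    by (cases "i = d - 1")
      (simp_all add: mirrored_def nth_append nth_tl rev_nth Suc_diff_Suc del: upt_Suc)
qed (use assms(3) in \<open>simp add: mirrored_def del: upt_Suc\<close>)

lemma (in newton_sequences) search_palindrome_imp_test:
  assumes search: "search (bounds_upto 1 (Suc d)) (test_palindrome (bounds_upto (Suc d) (Suc K)) test) [] []"
    and D: "D = 2 * d" and d: "1 \<le> d" "d \<le> K"
    and palindrome: "\<And>i. i \<le> 2 * d \<Longrightarrow> c (2 * d - i) = c i" "c 0 = 1"
  shows "test (coeffs_upto 1 (Suc D))"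
proof -
  have "search (bounds_upto 1 (Suc d)) (test_palindrome (bounds_upto (Suc d) (Suc K)) test)
      (coeffs_upto 1 1) (sums_below 1)"
    using search by simp
  then have test_palindrome:
    "test_palindrome (bounds_upto (Suc d) (Suc K)) test (coeffs_upto 1 (Suc d)) (sums_below (Suc d))"
    by (rule search_imp_test) (use d in auto)
  have coeffs: "coeffs_upto 1 (Suc d) @ coeffs_upto (Suc d) (Suc D) = coeffs_upto 1 (Suc D)"
    using upt_add_eq_append[of 1 "Suc d" d] by (simp add: D mult_2 del: upt_Suc flip: map_append)
  have "map (\<lambda>_. 0) (bounds_upto (Suc d) (Suc K)) = coeffs_upto (Suc D) (Suc D + (K - d))"
    by (rule nth_equalityI) (auto simp: coeff_eq_0 simp del: upt_Suc)
  then have padding: "coeffs_upto (Suc d) (Suc D) @ map (\<lambda>_. 0) (bounds_upto (Suc d) (Suc K))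
      = coeffs_upto (Suc d) (Suc D + (K - d))"
    using upt_add_eq_append[of "Suc d" "Suc D" "K - d"]
    by (simp add: D del: upt_Suc flip: map_append)
  have mirrored: "mirrored (coeffs_upto 1 (Suc d)) = coeffs_upto (Suc d) (Suc D)"
    unfolding D by (rule mirrored_map_upt) (use palindrome d in auto)
  have "extend_sums (bounds_upto (Suc d) (Suc K)) test (coeffs_upto 1 (Suc D))
      (coeffs_upto (Suc d) (Suc D + (K - d))) (sums_below (Suc d))"
    using test_palindrome unfolding test_palindrome_def mirrored coeffs padding .
  then show ?thesis
    by (rule extend_sums_imp_test) (use D d in auto)
qed

lemma loss_power_le:
  fixes y t :: real
  assumes "1 \<le> M" "M \<le> \<Lambda>" "excess (\<Lambda> ^ k) \<le> y\<^sup>2" "0 \<le> y" "5/2 * excess (\<Lambda> ^ k) + 4/5 * y \<le> t"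
  shows "loss (M ^ k) \<le> t"
proof -
  have "loss (M ^ k) \<le> loss (\<Lambda> ^ k)" using assms(1,2) by (intro loss_mono) (auto intro: power_mono)
  moreover have "sqrt (excess (\<Lambda> ^ k)) \<le> y" using assms(3,4) by (intro real_le_lsqrt)
  ultimately show ?thesis using assms(5) unfolding loss_def by argo
qed

lemma loss_power_le_sum_corrections:
  assumes "1 \<le> M" "M \<le> lehmer_upper" "1 \<le> k" "k \<le> 12"
  shows "loss (M ^ k) \<le> of_int (sum_corrections ! (k - 1)) / 1000"
proof -
  define roots :: "real list" where "roots = [813/5000, 1631/5000, 123/250, 661/1000, 1043/1250,
    10133/10000, 2997/2500, 13923/10000, 319/200, 18081/10000, 5083/2500, 22717/10000]"
  have "list_all (\<lambda>(k, t, y). excess (lehmer_upper ^ k) \<le> y\<^sup>2 \<and> 0 \<le> y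
      \<and> 5/2 * excess (lehmer_upper ^ k) + 4/5 * y \<le> of_int t / 1000)
    (zip [1, 2, 3, 4, 5, 6, 7, 8, 9, 10, 11, 12] (zip sum_corrections roots))"
    by (simp add: lehmer_upper_def excess_def sum_corrections_def roots_def power_divide)
  moreover have "[1, 2, 3, 4, 5, 6, 7, 8, 9, 10, 11, 12 :: nat] = [1..<Suc 12]"
    by (simp add: upt_rec)
  moreover have "length sum_corrections = 12" "length roots = 12"
    by (simp_all add: sum_corrections_def roots_def)
  moreover have "k - 1 < 12" "[1..<Suc 12] ! (k - 1) = k"
    using assms(3,4) by (simp_all del: upt_Suc)
  ultimately have "excess (lehmer_upper ^ k) \<le> (roots ! (k - 1))\<^sup>2 \<and> 0 \<le> roots ! (k - 1)
      \<and> 5/2 * excess (lehmer_upper ^ k) + 4/5 * roots ! (k - 1) \<le> of_int (sum_corrections ! (k - 1)) / 1000"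
    unfolding list_all_length by (auto simp del: upt_Suc One_nat_def dest!: spec[of _ "k - 1"])
  then show ?thesis using loss_power_le[OF assms(1,2)] by blast
qed

lemma power_power_2_le_nth:
  fixes us :: "'a :: linordered_semidom list"
  assumes "successively (\<lambda>u v. u\<^sup>2 \<le> v) us" "i < length us" "hd us \<ge> 0"
  shows "hd us ^ 2 ^ i \<le> us ! i"
  using assms(2)
proof (induction i)
  case 0
  then show ?case by (simp add: hd_conv_nth)
next
  case (Suc i)
  have "hd us ^ 2 ^ Suc i = (hd us ^ 2 ^ i)\<^sup>2"
    by (simp add: power_mult[symmetric] mult.commute)
  also have "\<dots> \<le> (us ! i)\<^sup>2" using Suc assms(3) by (intro power_mono) auto
  also have "\<dots> \<le> us ! Suc i" using assms(1) Suc.prems by (simp add: successively_conv_nth)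
  finally show ?case .
qed

lemma lehmer_upper_power_le_graeffe_bounds:
  assumes "i < length graeffe_bounds"
  shows "lehmer_upper ^ 2 ^ i \<le> of_int (graeffe_bounds ! i)"
proof -
  define us :: "real list" where "us = [11763/10000, 13836817/10000000, 119661/62500, 366561/100000,
    134367/10000, 36109/200, 32600, 1062800000, 1129600000000000000]"
  have "lehmer_upper ^ 2 ^ i \<le> us ! i"
    using power_power_2_le_nth[of us i] assms
    by (simp add: us_def graeffe_bounds_def lehmer_upper_def power_divide)
  moreover have "list_all2 (\<lambda>u N. u \<le> of_int N) us graeffe_bounds"
    by (simp add: us_def graeffe_bounds_def)
  ultimately show ?thesis using assms by (force simp: list_all2_conv_all_nth)
qed

lemma Poly_rev_coeffs: "Poly_rev (coeffs q) = reflect_poly q"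
  by (simp add: Poly_rev_def reflect_poly_def)

lemma reject_imp_dvd:
  assumes "reject (binomials d) cs" and cs: "1 # cs = coeffs q"
    and q: "reflect_poly q = q" "degree q = 2 * d" and M: "mahler_measure q \<le> lehmer_upper"
  shows "\<exists>p\<in>set forbidden_divisors. Poly_rev (1 # p) dvd q"
proof -
  have "\<not> graeffe_exceeds graeffe_bounds (binomials d) (coeffs q)"
  proof (rule not_graeffe_exceeds[where m = 0, OF _ M])
    show "binomials d ! j = int (degree q choose j)" if "j < length (binomials d)" for j
      using that by (simp add: binomials_def q(2) del: upt_Suc)
    show "lehmer_upper ^ 2 ^ (0 + i) \<le> of_int (graeffe_bounds ! i)" if "i < length graeffe_bounds"
      for i
      using lehmer_upper_power_le_graeffe_bounds[OF that] by simp
  qed (simp_all add: q(2) graeffe_poly_impl_def)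
  then have "has_divisor (map snd cyclotomics) (coeffs q) \<or> has_divisor (map snd more_cyclotomics @ lehmer_lists) (coeffs q)"
    using assms(1) unfolding reject_def cs by (auto split: if_splits)
  then show ?thesis
    using has_divisor_imp_dvd[of _ "coeffs q"] unfolding Poly_rev_coeffs q(1) by fastforce
qed

lemma abs_le_sum_bound:
  assumes q: "monic q" "reflect_poly q = q" "root_of_unity_free q" "degree q = 2 * d"
    and M: "mahler_measure q \<le> lehmer_upper" and k: "1 \<le> k" "k \<le> 12"
    and s: "power_sum (complex_roots_int q) k = of_int s"
  shows "\<bar>s\<bar> \<le> sum_bound d k"
proof -
  define t where "t = sum_corrections ! (k - 1)"
  have "mahler_measure q \<ge> 1" using q(1) by (intro mahler_measure_poly_ge_1) auto
  then have "loss (mahler_measure q ^ k) \<le> of_int t / 1000"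
    unfolding t_def using M k by (rule loss_power_le_sum_corrections)
  moreover have "of_int \<bar>s\<bar> \<le> 543/2000 * real (degree q) + loss (mahler_measure q ^ k)"
    using abs_power_sum_le[OF q(1-3) k(1)] by (simp add: s)
  moreover have "real (degree q) = 2 * real d" by (simp add: q(4))
  ultimately have "1000 * of_int \<bar>s\<bar> \<le> 543 * real d + of_int t" by argo
  then have "real_of_int (1000 * \<bar>s\<bar>) \<le> of_int (543 * int d + t)" by simp
  then have "1000 * \<bar>s\<bar> \<le> 543 * int d + t" by (simp only: of_int_le_iff)
  then have "(1000 * \<bar>s\<bar>) div 1000 \<le> (543 * int d + t) div 1000" by (intro zdiv_mono1) auto
  then show ?thesis by (simp add: sum_bound_def t_def)
qed

lemma search_degree_imp_dvd:
  assumes q: "monic q" "reflect_poly q = q" "root_of_unity_free q" "degree q = 2 * d"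
    and M: "mahler_measure q \<le> lehmer_upper" and d: "1 \<le> d" "d \<le> 12"
    and search: "search_degree d"
  shows "\<exists>p\<in>set forbidden_divisors. Poly_rev (1 # p) dvd q"
proof -
  have "\<exists>x::int. power_sum (complex_roots_int q) k = of_int x" for k
    using power_sum_roots_Ints[OF q(1), of k] by (auto simp: Ints_def)
  then obtain s :: "nat \<Rightarrow> int" where s: "\<And>k. power_sum (complex_roots_int q) k = of_int (s k)"
    by metis
  interpret newton_sequences "coeff q" s "sum_bound d" "2 * d" 12
  proof
    fix n :: nat
    assume "n \<ge> 1"
    then have "complex_of_int (s n) = of_int (- (int n * coeff q n + (\<Sum>i=1..<n. coeff q i * s (n - i))))"
      using power_sum_roots_recursion[OF q(1), of n] by (simp add: s q(2))
    then show "s n = - (int n * coeff q n + (\<Sum>i=1..<n. coeff q i * s (n - i)))"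
      by (simp only: of_int_eq_iff)
  qed (use q abs_le_sum_bound[OF q M _ _ s] in \<open>auto simp: coeff_eq_0\<close>)
  have symmetric: "coeff q (2 * d - i) = coeff q i" if "i \<le> 2 * d" for i
    using coeff_reflect_poly[of q i] that by (simp add: q(2,4))
  have c0: "coeff q 0 = 1" using symmetric[of 0] q(1,4) by simp
  have "reject (binomials d) (coeffs_upto 1 (Suc (2 * d)))"
    using search unfolding search_degree_def
    by (rule search_palindrome_imp_test) (fact refl d symmetric c0)+
  moreover have "1 # coeffs_upto 1 (Suc (2 * d)) = coeffs q"
    using q(1,4) c0 by (auto simp: coeffs_def upt_conv_Cons simp del: upt_Suc)
  ultimately show ?thesis
    using reject_imp_dvd[OF _ _ q(2,4) M] by blast
qed

section \<open>Lehmer's polynomial\<close>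

lemma poly_of_int_lehmer:
  fixes t :: "'a :: comm_ring_1"
  shows "poly (of_int_poly lehmer_poly) t = t^10 + t^9 - t^7 - t^6 - t^5 - t^4 - t^3 + t + 1"
  by (simp add: lehmer_poly_def algebra_simps eval_nat_numeral)

lemma monic_lehmer_poly: "monic lehmer_poly" and degree_lehmer_poly: "degree lehmer_poly = 10"
  by (simp_all add: lehmer_poly_def)

lemma reflect_lehmer_poly: "reflect_poly lehmer_poly = lehmer_poly"
  by (simp add: lehmer_poly_def reflect_poly_def)

definition lehmer_trace :: "'a :: comm_ring_1 \<Rightarrow> 'a" where
  "lehmer_trace x = x ^ 5 + x ^ 4 - 5 * x ^ 3 - 5 * x\<^sup>2 + 4 * x + 3"

lemma poly_lehmer_eq_trace:
  fixes x z :: "'a :: comm_ring_1"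
  assumes "z\<^sup>2 + 1 = x * z"
  shows "poly (of_int_poly lehmer_poly) z = z ^ 5 * lehmer_trace x"
proof -
  have "poly (of_int_poly lehmer_poly) z = (z\<^sup>2 + 1) ^ 5 + z * (z\<^sup>2 + 1) ^ 4 - 5 * z\<^sup>2 * (z\<^sup>2 + 1) ^ 3
      - 5 * z ^ 3 * (z\<^sup>2 + 1)\<^sup>2 + 4 * z ^ 4 * (z\<^sup>2 + 1) + 3 * z ^ 5"
    unfolding poly_of_int_lehmer by (simp add: algebra_simps eval_nat_numeral)
  also have "\<dots> = z ^ 5 * lehmer_trace x"
    unfolding assms lehmer_trace_def by (simp add: algebra_simps eval_nat_numeral)
  finally show ?thesis .
qed

definition unit_point :: "real \<Rightarrow> complex" where
  "unit_point x = Complex (x / 2) (sqrt (1 - (x / 2)\<^sup>2))"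

lemma unit_point:
  assumes "\<bar>x\<bar> < 2"
  shows "cmod (unit_point x) = 1" and "Im (unit_point x) > 0"
    and "(unit_point x)\<^sup>2 + 1 = of_real x * unit_point x"
proof -
  have pos: "(x / 2)\<^sup>2 < 1" using assms by (simp add: abs_square_less_1)
  then show "cmod (unit_point x) = 1" "Im (unit_point x) > 0"
    by (simp_all add: unit_point_def cmod_def)
  show "(unit_point x)\<^sup>2 + 1 = of_real x * unit_point x"
    using pos by (simp add: unit_point_def complex_eq_iff power2_eq_square field_simps)
qed

lemma lehmer_trace_roots:
  obtains X :: "real set" where "finite X" "card X = 4" "\<And>x. x \<in> X \<Longrightarrow> \<bar>x\<bar> < 2" "\<And>x. x \<in> X \<Longrightarrow> lehmer_trace x = 0"
proof -
  let ?g = "lehmer_trace :: real \<Rightarrow> real"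
  have cont: "continuous_on A ?g" for A
    unfolding lehmer_trace_def by (intro continuous_intros)
  obtain x1 :: real where x1: "-19/10 \<le> x1" "x1 \<le> -18/10" "lehmer_trace x1 = 0"
    using IVT'[of ?g "-19/10" 0 "-18/10"] cont by (auto simp: lehmer_trace_def power_divide)
  obtain x2 :: real where x2: "-15/10 \<le> x2" "x2 \<le> -14/10" "lehmer_trace x2 = 0"
    using IVT2'[of ?g "-14/10" 0 "-15/10"] cont by (auto simp: lehmer_trace_def power_divide)
  obtain x3 :: real where x3: "-6/10 \<le> x3" "x3 \<le> -5/10" "lehmer_trace x3 = 0"
    using IVT'[of ?g "-6/10" 0 "-5/10"] cont by (auto simp: lehmer_trace_def power_divide)
  obtain x4 :: real where x4: "9/10 \<le> x4" "x4 \<le> 1" "lehmer_trace x4 = 0"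
    using IVT2'[of ?g 1 0 "9/10"] cont by (auto simp: lehmer_trace_def power_divide)
  show ?thesis
    using x1 x2 x3 x4 by (intro that[of "{x1, x2, x3, x4}"]) auto
qed

lemma lehmer_roots_on_unit_circle:
  obtains U :: "complex set" where "finite U" "card U = 8" "\<And>z. z \<in> U \<Longrightarrow> cmod z = 1"
    "\<And>z. z \<in> U \<Longrightarrow> poly (of_int_poly lehmer_poly) z = 0"
proof -
  obtain X :: "real set" where X: "finite X" "card X = 4" "\<And>x. x \<in> X \<Longrightarrow> \<bar>x\<bar> < 2"
    "\<And>x. x \<in> X \<Longrightarrow> lehmer_trace x = 0"
    by (rule lehmer_trace_roots) blast
  define W where "W = unit_point ` X"
  have trace_0: "lehmer_trace (complex_of_real x) = 0" if "x \<in> X" for x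
  proof -
    have "lehmer_trace (complex_of_real x) = of_real (lehmer_trace x)"
      by (simp add: lehmer_trace_def)
    then show ?thesis using X(4)[OF that] by simp
  qed
  have root: "poly (of_int_poly lehmer_poly) (unit_point x) = 0" if "x \<in> X" for x
    using poly_lehmer_eq_trace[OF unit_point(3)[OF X(3)[OF that]]] trace_0[OF that] by simp
  have root_cnj: "poly (of_int_poly lehmer_poly) (cnj (unit_point x)) = 0" if "x \<in> X" for x
  proof -
    have "(cnj (unit_point x))\<^sup>2 + 1 = of_real x * cnj (unit_point x)"
      using arg_cong[OF unit_point(3)[OF X(3)[OF that]], of cnj] by simp
    from poly_lehmer_eq_trace[OF this] trace_0[OF that] show ?thesis by simp
  qed
  show ?thesis
  proof (rule that[of "W \<union> cnj ` W"])
    have "card W = 4"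
      unfolding W_def using X(2) by (subst card_image) (auto simp: inj_on_def unit_point_def)
    moreover have "card (cnj ` W) = card W" by (rule card_image) (simp add: inj_on_def)
    moreover have "\<forall>w\<in>W. Im w > 0" "\<forall>w\<in>cnj ` W. Im w < 0"
      using unit_point(2)[OF X(3)] by (auto simp: W_def)
    then have "W \<inter> cnj ` W = {}" by (metis disjoint_iff less_asym)
    ultimately show "card (W \<union> cnj ` W) = 8"
      using X(1) by (simp add: card_Un_disjoint W_def)
  qed (use X(1) unit_point(1)[OF X(3)] root root_cnj in \<open>auto simp: W_def\<close>)
qed

lemma prod_list_roots_eq_prod:
  assumes "monic f" "finite R" "card R = degree f" "\<And>z. z \<in> R \<Longrightarrow> poly (of_int_poly f) z = 0"
  shows "(\<Prod>\<alpha>\<leftarrow>complex_roots_int f. h \<alpha>) = (\<Prod>\<alpha>\<in>R. h \<alpha>)"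
proof -
  have "f \<noteq> 0" using assms(1) by auto
  then have sub: "R \<subseteq> set (complex_roots_int f)"
    using assms(4) by (auto simp: set_complex_roots_int)
  have "card (set (complex_roots_int f)) \<le> card R"
    using card_length[of "complex_roots_int f"] by (simp add: complex_roots_int(2) assms(3))
  then have set: "set (complex_roots_int f) = R"
    using sub by (metis List.finite_set card_seteq)
  then have "distinct (complex_roots_int f)"
    by (simp add: card_distinct complex_roots_int(2) assms(3))
  then show ?thesis using set by (simp flip: prod.distinct_set_conv_list)
qed

lemma lehmer_real_root:
  obtains l :: real where "1 < l" "l \<le> lehmer_upper"
    "poly (of_int_poly lehmer_poly) l = 0" "poly (of_int_poly lehmer_poly) (1 / l) = 0"
proof -
  define L :: "real \<Rightarrow> real" where "L = poly (of_int_poly lehmer_poly)"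
  have L: "L t = t^10 + t^9 - t^7 - t^6 - t^5 - t^4 - t^3 + t + 1" for t
    by (simp add: L_def poly_of_int_lehmer)
  have "continuous_on A L" for A unfolding L_def by (intro continuous_intros)
  then obtain l where l: "1 \<le> l" "l \<le> lehmer_upper" "L l = 0"
    using IVT'[of L 1 0 lehmer_upper] by (auto simp: L lehmer_upper_def power_divide)
  have "l \<noteq> 1" using l(3) by (auto simp: L)
  then have "1 < l" using l(1) by simp
  moreover have "L l = l ^ 10 * L (1 / l)"
    using poly_reflect_poly_nz[of l "of_int_poly lehmer_poly"] \<open>1 < l\<close>
    by (simp add: L_def reflect_of_int_poly reflect_lehmer_poly degree_lehmer_poly inverse_eq_divide)
  then have "L (1 / l) = 0" using l(3) \<open>1 < l\<close> by simp
  ultimately show ?thesis using that[of l] l by (simp add: L_def)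
qed

lemma lehmer_number_bounds: "lehmer_number > 1" "lehmer_number \<le> lehmer_upper"
proof -
  obtain l :: real where l: "1 < l" "l \<le> lehmer_upper"
    and root: "poly (of_int_poly lehmer_poly) l = 0" "poly (of_int_poly lehmer_poly) (1 / l) = 0"
    by (rule lehmer_real_root)
  obtain U :: "complex set" where U: "finite U" "card U = 8" "\<And>z. z \<in> U \<Longrightarrow> cmod z = 1"
    "\<And>z. z \<in> U \<Longrightarrow> poly (of_int_poly lehmer_poly) z = 0"
    by (rule lehmer_roots_on_unit_circle) blast
  define R where "R = insert (of_real l) (insert (of_real (1 / l)) U)"
  have notU: "complex_of_real l \<notin> U" "complex_of_real (1 / l) \<notin> U"
    using U(3)[of "of_real l"] U(3)[of "of_real (1 / l)"] l by (auto simp: norm_divide)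
  have "1 / l < l" using l(1) by (smt (verit) divide_less_eq_1)
  then have distinct: "complex_of_real l \<noteq> of_real (1 / l)" by (simp only: of_real_eq_iff)
  have "poly (of_int_poly lehmer_poly) (complex_of_real t) = of_real (poly (of_int_poly lehmer_poly) t)" for t
    by (simp add: poly_of_int_lehmer)
  then have "poly (of_int_poly lehmer_poly) z = 0" if "z \<in> R" for z
    using that U(4) root by (auto simp: R_def simp del: of_real_divide)
  moreover have "finite R" "card R = degree lehmer_poly"
    using U(1,2) notU distinct by (auto simp: R_def degree_lehmer_poly)
  ultimately have "lehmer_number = (\<Prod>\<alpha>\<in>R. max 1 (cmod \<alpha>))"
    unfolding lehmer_number_def mahler_measure_monic_eq[OF monic_lehmer_poly]
    by (intro prod_list_roots_eq_prod monic_lehmer_poly)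
  also have "\<dots> = max 1 (cmod (of_real l)) * (max 1 (cmod (of_real (1 / l))) * (\<Prod>\<alpha>\<in>U. max 1 (cmod \<alpha>)))"
    unfolding R_def using U(1) notU distinct by simp
  also have "\<dots> = l"
    using l(1) U(3) by (simp add: norm_divide max_def)
  finally show "lehmer_number > 1" "lehmer_number \<le> lehmer_upper" using l by simp_all
qed

section \<open>Degree at most 16\<close>

lemma cyclotomics_certificate:
  "list_all (\<lambda>(n, p). n \<ge> 1 \<and> p \<noteq> [] \<and> list_divides p (1 # replicate (n - 1) 0 @ [-1]))
    (cyclotomics @ more_cyclotomics)"
  by code_simp

lemma pCons_minus_1: "[:-1:] = (-1 :: 'a :: comm_ring_1 poly)"
  by (metis minus_pCons minus_zero one_pCons)

lemma Poly_rev_power_minus_1: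
  assumes "n \<ge> 1"
  shows "Poly_rev (1 # replicate (n - 1) 0 @ [-1]) = monom 1 n - 1"
proof -
  have "Poly_rev (replicate k 0 @ [-1]) = -1" for k
    by (induction k) (simp_all add: Poly_rev_Cons Poly_rev_Nil monom_0 pCons_minus_1)
  then show ?thesis using assms by (simp add: Poly_rev_Cons)
qed

lemma monic_Poly_rev: "monic (Poly_rev (1 # p))"
  and degree_Poly_rev: "degree (Poly_rev (1 # p)) = length p"
proof -
  have coeff: "coeff (Poly_rev (1 # p)) i = nth_default 0 (rev p @ [1]) i" for i
    by (simp add: Poly_rev_def coeff_Poly_eq)
  have "degree (Poly_rev (1 # p)) \<le> length p"
    by (rule degree_le) (auto simp: coeff nth_default_def)
  moreover have top: "coeff (Poly_rev (1 # p)) (length p) = 1"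
    by (simp add: coeff nth_default_def nth_append)
  ultimately show "degree (Poly_rev (1 # p)) = length p"
    using le_degree[of "Poly_rev (1 # p)" "length p"] by simp
  with top show "monic (Poly_rev (1 # p))" by simp
qed

lemma mahler_measure_cyclotomics:
  assumes "p \<in> set (map snd cyclotomics @ map snd more_cyclotomics)"
  shows "mahler_measure (Poly_rev (1 # p)) = 1" and "degree (Poly_rev (1 # p)) \<ge> 1"
proof -
  have "\<exists>n. (n, p) \<in> set (cyclotomics @ more_cyclotomics)" using assms by auto
  then obtain n where n: "n \<ge> 1" "p \<noteq> []" "list_divides p (1 # replicate (n - 1) 0 @ [-1])"
    using cyclotomics_certificate unfolding list_all_iff by blast
  have "Poly_rev (1 # p) dvd monom 1 n - 1"
    using list_divides_imp_dvd[OF n(3)] unfolding Poly_rev_power_minus_1[OF n(1)] .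
  with n(1) show "mahler_measure (Poly_rev (1 # p)) = 1"
    by (rule mahler_measure_eq_1_if_dvd_monom_minus_1)
  show "degree (Poly_rev (1 # p)) \<ge> 1" using n(2) by (simp add: degree_Poly_rev Suc_le_eq)
qed

lemma mahler_measure_lehmer_lists:
  assumes "p \<in> set lehmer_lists"
  shows "mahler_measure (Poly_rev (1 # p)) = lehmer_number"
proof -
  have "Poly_rev [1, 1, 0, -1, -1, -1, -1, -1, 0, 1, 1] = lehmer_poly"
    by (simp add: Poly_rev_def lehmer_poly_def)
  moreover have "Poly_rev [1, -1, 0, 1, -1, 1, -1, 1, 0, -1, 1] = pcompose lehmer_poly [:0, -1:]"
    by (intro poly_eq_poly_eq_iff[THEN iffD1] ext)
       (simp add: Poly_rev_def lehmer_poly_def poly_pcompose algebra_simps)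
  ultimately have "Poly_rev (1 # p) = lehmer_poly \<or> Poly_rev (1 # p) = pcompose lehmer_poly [:0, -1:]"
    using assms by (auto simp: lehmer_lists_def)
  then show ?thesis by (auto simp: lehmer_number_def mahler_measure_pcompose_neg)
qed

lemma search_degree_le_8:
  assumes "1 \<le> d" "d \<le> 8"
  shows "search_degree d"
proof -
  have "list_all search_degree [1, 2, 3, 4, 5, 6, 7, 8]" by code_simp
  moreover have "d \<in> set [1, 2, 3, 4, 5, 6, 7, 8]" using assms by auto
  ultimately show ?thesis unfolding list_all_iff by blast
qed

lemma lehmer_number_less_nonreciprocal_bound: "lehmer_number < nonreciprocal_bound"
proof -
  have "4 \<le> sqrt 17" by (rule real_le_rsqrt) simp
  then show ?thesis
    using lehmer_number_bounds(2) by (simp add: nonreciprocal_bound_def lehmer_upper_def)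
qed

lemma root_of_unity_free_imp_not_antireciprocal:
  assumes "root_of_unity_free q"
  shows "reflect_poly q \<noteq> - q"
proof
  assume "reflect_poly q = - q"
  then have "poly (of_int_poly q) (1 :: complex) = - poly (of_int_poly q) 1"
    using poly_reflect_poly_nz[of "1 :: complex" "of_int_poly q"]
    by (simp add: reflect_of_int_poly of_int_poly_hom.hom_uminus)
  then have "poly (of_int_poly q) (1 :: complex) = 0" by simp
  then show False using assms[unfolded root_of_unity_free_def, rule_format, of 1 1] by simp
qed

lemma root_of_unity_free_reciprocal_imp_even:
  assumes "root_of_unity_free q" "reflect_poly q = q"
  shows "even (degree q)"
proof (rule ccontr)
  assume "odd (degree q)"
  then have "poly (of_int_poly q) (-1 :: complex) = - poly (of_int_poly q) (-1)"
    using poly_reflect_poly_nz[of "-1 :: complex" "of_int_poly q"]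
    by (simp add: reflect_of_int_poly assms(2))
  then have "poly (of_int_poly q) (-1 :: complex) = 0" by simp
  then show False using assms(1)[unfolded root_of_unity_free_def, rule_format, of 2 "-1"] by simp
qed

locale minimal_lehmer_counterexample =
  fixes q :: "int poly"
  assumes monic: "monic q" and gt_1: "mahler_measure q > 1" and less_lehmer: "mahler_measure q < lehmer_number"
    and minimal: "monic f \<Longrightarrow> 1 < mahler_measure f \<Longrightarrow> mahler_measure f < lehmer_number \<Longrightarrow> degree q \<le> degree f"
begin

lemma no_factor_mahler_measure_1:
  assumes "monic p" "degree p \<ge> 1" "p dvd q"
  shows "mahler_measure p \<noteq> 1"
proof
  assume M: "mahler_measure p = 1"
  obtain h where h: "q = p * h" using assms(3) by blast
  then have "monic h" using monic_factor[of p h] monic assms(1) by simp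
  moreover have "mahler_measure h = mahler_measure q" using h M by (simp add: mahler_measure_mult)
  ultimately have "degree q \<le> degree h" using minimal gt_1 less_lehmer by simp
  moreover have "p \<noteq> 0" "h \<noteq> 0" using h monic by auto
  then have "degree q = degree p + degree h" using h by (simp add: degree_mult_eq)
  ultimately show False using assms(2) by simp
qed

lemma root_of_unity_free: "root_of_unity_free q"
  unfolding root_of_unity_free_def
proof (intro allI impI notI)
  fix \<alpha> :: complex and n :: nat
  assume "n \<ge> 1" "poly (of_int_poly q) \<alpha> = 0" "\<alpha> ^ n = 1"
  then show False using monic_factor_if_root_of_unity[OF monic] no_factor_mahler_measure_1 by metis
qed

lemma coeff_0_nonzero: "coeff q 0 \<noteq> 0"
proof
  assume "coeff q 0 = 0"
  then have "[:0, 1:] dvd q" using poly_eq_0_iff_dvd[of q 0] by (simp add: poly_0_coeff_0)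
  then show False
    using no_factor_mahler_measure_1[of "[:0, 1:]"] mahler_measure_linear[of 0] by simp
qed

lemma reciprocal: "reflect_poly q = q"
proof (rule ccontr)
  assume nonrec: "reflect_poly q \<noteq> q"
  moreover have "reflect_poly q \<noteq> - q"
    by (rule root_of_unity_free_imp_not_antireciprocal[OF root_of_unity_free])
  ultimately have "mahler_measure q \<ge> nonreciprocal_bound"
    by (intro nonreciprocal_mahler_measure_ge monic coeff_0_nonzero) (auto simp: equation_minus_iff)
  then show False using less_lehmer lehmer_number_less_nonreciprocal_bound by simp
qed

lemma degree_greater_16: "degree q > 16"
proof (rule ccontr)
  assume "\<not> degree q > 16"
  obtain d where d: "degree q = 2 * d"
    using root_of_unity_free_reciprocal_imp_even[OF root_of_unity_free reciprocal] by blast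
  have "d \<noteq> 0" using monic_degree_0[OF monic] d gt_1 by auto
  then have d_range: "1 \<le> d" "d \<le> 8" using d \<open>\<not> degree q > 16\<close> by auto
  have "mahler_measure q \<le> lehmer_upper" using less_lehmer lehmer_number_bounds(2) by linarith
  then obtain p where p: "p \<in> set forbidden_divisors"
      "Poly_rev (1 # p) dvd q"
    using search_degree_imp_dvd[OF monic reciprocal root_of_unity_free d] d_range search_degree_le_8[OF d_range]
    by auto
  then consider (cyclotomic) "p \<in> set (map snd cyclotomics @ map snd more_cyclotomics)"
    | (lehmer) "p \<in> set lehmer_lists"
    by auto
  then show False
  proof cases
    case cyclotomic
    then show False
      using no_factor_mahler_measure_1[OF monic_Poly_rev _ p(2)] mahler_measure_cyclotomics by blast
  next
    case lehmer
    have "q \<noteq> 0" using monic by auto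
    then show False
      using mahler_measure_dvd[OF _ p(2)] mahler_measure_lehmer_lists[OF lehmer] less_lehmer by simp
  qed
qed

end

lemma mahler_measure_degree_le_16:
  assumes "monic f" "degree f \<le> 16" "mahler_measure f > 1"
  shows "mahler_measure f \<ge> lehmer_number"
proof (rule ccontr)
  define counterexample where
    "counterexample g \<longleftrightarrow> monic g \<and> 1 < mahler_measure g \<and> mahler_measure g < lehmer_number" for g
  assume "\<not> mahler_measure f \<ge> lehmer_number"
  then have "counterexample f" using assms by (simp add: counterexample_def)
  define q where "q = arg_min degree counterexample"
  have "counterexample q"
    using arg_min_natI[of counterexample f degree] \<open>counterexample f\<close> by (simp add: q_def)
  have min: "degree q \<le> degree g" if "counterexample g" for g
    using arg_min_nat_le[of counterexample g degree] that by (simp add: q_def)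
  interpret minimal_lehmer_counterexample q
    by unfold_locales (use \<open>counterexample q\<close> min in \<open>auto simp: counterexample_def\<close>)
  show False using degree_greater_16 min[OF \<open>counterexample f\<close>] assms(2) by simp
qed

section \<open>Reciprocal and skew-reciprocal minima\<close>

lemma coeff_pcompose_monom_eq:
  fixes g :: "'a :: comm_ring_1 poly"
  assumes "n \<ge> 1"
  shows "coeff (g \<circ>\<^sub>p monom 1 n) j = (if n dvd j then coeff g (j div n) else 0)"
  using coeff_pcompose_monom[of "j mod n" n g "j div n"] assms
  by (simp add: mod_eq_0_iff_dvd)

lemma reflect_poly_pcompose_monom:
  fixes g :: "'a :: idom poly"
  assumes "n \<ge> 1"
  shows "reflect_poly (g \<circ>\<^sub>p monom 1 n) = reflect_poly g \<circ>\<^sub>p monom 1 n"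
proof (rule poly_eqI)
  fix j
  have deg: "degree (g \<circ>\<^sub>p monom 1 n) = n * degree g"
    by (simp add: degree_pcompose degree_monom_eq)
  show "coeff (reflect_poly (g \<circ>\<^sub>p monom 1 n)) j = coeff (reflect_poly g \<circ>\<^sub>p monom 1 n) j"
  proof (cases "n dvd j")
    case True
    then obtain i where j: "j = n * i" by blast
    have "n * degree g - n * i = n * (degree g - i)" by (simp add: diff_mult_distrib2)
    then show ?thesis
      using assms
      unfolding coeff_reflect_poly deg j by (simp add: coeff_pcompose_monom_eq coeff_reflect_poly)
  next
    case False
    then have "\<not> n dvd n * degree g - j" if "j \<le> n * degree g"
      using that dvd_diffD1[of n "n * degree g" j] by auto
    then show ?thesis
      using assms False unfolding coeff_reflect_poly deg by (simp add: coeff_pcompose_monom_eq)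
  qed
qed

lemma pcompose_monom_poly_square_subst:
  fixes f :: "'a :: {idom, ring_char_0} poly"
  assumes "f \<circ>\<^sub>p [:0, -1:] = f"
  shows "poly_square_subst f \<circ>\<^sub>p monom 1 2 = f"
proof (rule poly_eqI)
  fix j
  have "coeff f j = (-1) ^ j * coeff f j"
    using arg_cong[OF assms, of "\<lambda>p. coeff p j"] by (simp add: coeff_pcompose_linear)
  then have "coeff f j = 0" if "odd j" using that by simp
  then show "coeff (poly_square_subst f \<circ>\<^sub>p monom 1 2) j = coeff f j"
    by (simp add: coeff_pcompose_monom_eq poly_square_subst_coeff)
qed

lemma pcompose_monom_square_even:
  fixes g :: "'a :: comm_ring_1 poly"
  shows "(g \<circ>\<^sub>p monom 1 2) \<circ>\<^sub>p [:0, -1:] = g \<circ>\<^sub>p monom 1 2"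
  by (intro poly_eqI) (simp add: coeff_pcompose_linear coeff_pcompose_monom_eq)

lemma monic_pcompose_monom_iff:
  fixes g :: "'a :: idom poly"
  assumes "n \<ge> 1"
  shows "monic (g \<circ>\<^sub>p monom 1 n) \<longleftrightarrow> monic g"
  using assms lead_coeff_comp[of "monom 1 n" g] by (simp add: degree_monom_eq)

lemma skew_reciprocal_pcompose_square:
  assumes "reciprocal_poly g" "even (degree g)"
  shows "skew_reciprocal_poly (g \<circ>\<^sub>p monom 1 2)"
  using assms unfolding skew_reciprocal_poly_def reciprocal_poly_def
  by (simp add: degree_monom_eq pcompose_monom_square_even reflect_poly_pcompose_monom)

lemma skew_reciprocal_eq_pcompose_square:
  assumes f: "monic f" "skew_reciprocal_poly f" "degree f = 2 * d" "even d"
    and M: "mahler_measure f < nonreciprocal_bound"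
  obtains g where "f = g \<circ>\<^sub>p monom 1 2" "monic g" "reciprocal_poly g" "degree g = d"
proof -
  define h where "h = f \<circ>\<^sub>p [:0, -1:]"
  have f_eq: "f = reflect_poly h" using f(2-4) by (simp add: skew_reciprocal_poly_def h_def)
  have "lead_coeff h = 1"
    using f(1,3) by (simp add: h_def coeff_pcompose_linear degree_pcompose)
  then have "coeff f 0 = 1" by (simp add: f_eq)
  then have "coeff h 0 = 1" by (simp add: h_def poly_0_coeff_0)
  then have reflect_f: "reflect_poly f = h" by (simp add: f_eq)
  have "f = h \<or> f = - h"
    using nonreciprocal_mahler_measure_ge[OF f(1)] \<open>coeff f 0 = 1\<close> M
    by (fastforce simp: reflect_f)
  moreover have "f \<noteq> - h" using \<open>coeff f 0 = 1\<close> \<open>coeff h 0 = 1\<close> by auto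
  ultimately have "f = h" by simp
  define g where "g = poly_square_subst f"
  have g: "f = g \<circ>\<^sub>p monom 1 2"
    unfolding g_def
    by (rule pcompose_monom_poly_square_subst[symmetric])
      (simp add: \<open>f = h\<close>[folded h_def, symmetric] flip: h_def)
  show ?thesis
  proof (rule that[OF g])
    show "monic g" using f(1) monic_pcompose_monom_iff[of 2 g] unfolding g by simp
    show "degree g = d" using f(3) unfolding g by (simp add: degree_pcompose degree_monom_eq)
    have "reflect_poly g \<circ>\<^sub>p monom 1 2 = g \<circ>\<^sub>p monom 1 2"
      using reflect_f \<open>f = h\<close> by (simp add: g flip: reflect_poly_pcompose_monom)
    then show "reciprocal_poly g"
      unfolding reciprocal_poly_def by (metis poly_square_subst)
  qed
qed

lemma reciprocal_same_mahler_measure: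
  assumes "monic f" "mahler_measure f < nonreciprocal_bound"
  obtains g where "monic g" "reciprocal_poly g" "mahler_measure g = mahler_measure f"
proof -
  have "f \<noteq> 0" using assms(1) by auto
  then obtain k h where h: "f = [:0, 1:] ^ k * h" "\<not> [:0, 1:] dvd h"
    using order_decomp[of f 0] by auto
  have "monic h" using monic_factor[of "[:0, 1:] ^ k" h] h(1) assms(1) by (simp add: monic_power)
  have M: "mahler_measure h = mahler_measure f"
    unfolding h(1) mahler_measure_mult mahler_measure_power
    using mahler_measure_linear[of 0] by simp
  have "coeff h 0 \<noteq> 0" using h(2) poly_eq_0_iff_dvd[of h 0] by (simp add: poly_0_coeff_0)
  then consider (reciprocal) "h = reflect_poly h" | (antireciprocal) "h = - reflect_poly h"
    using nonreciprocal_mahler_measure_ge[OF \<open>monic h\<close>] assms(2) M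
    by fastforce
  then show ?thesis
  proof cases
    case reciprocal
    then show ?thesis using that[of h] \<open>monic h\<close> M by (simp add: reciprocal_poly_def)
  next
    case antireciprocal
    define l :: "int poly" where "l = [:-1, 1:]"
    have l: "monic l" "mahler_measure l = 1" "reflect_poly l = - l"
      using mahler_measure_linear[of "-1"] by (simp_all add: l_def reflect_poly_def pCons_minus_1)
    have "reflect_poly h = - h" using antireciprocal by (metis minus_minus)
    then have "reciprocal_poly (h * l)" by (simp add: reciprocal_poly_def reflect_poly_mult l)
    moreover have "monic (h * l)" using \<open>monic h\<close> l(1) by (rule monic_mult)
    ultimately show ?thesis using that[of "h * l"] M l(2) by (simp add: mahler_measure_mult)
  qed
qed

lemma is_smallest_unique: "is_smallest x A \<Longrightarrow> is_smallest y A \<Longrightarrow> x = y"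
  unfolding is_smallest_def by (meson antisym)

lemma is_smallest_exists:
  assumes "a \<in> A" "finite (A \<inter> {..a})"
  shows "\<exists>x. is_smallest x A"
proof -
  have "A \<inter> {..a} \<noteq> {}" using assms(1) by blast
  with assms(2) have min: "Min (A \<inter> {..a}) \<in> A \<inter> {..a}" by (rule Min_in)
  have "Min (A \<inter> {..a}) \<le> y" if "y \<in> A" for y
    using min that assms(2) by (cases "y \<le> a") (auto intro: Min_le)
  then show ?thesis using min unfolding is_smallest_def by blast
qed

definition reciprocal_measures :: "nat \<Rightarrow> real set" where
  "reciprocal_measures i =
     {mahler_measure f |f. monic f \<and> reciprocal_poly f \<and> degree f = 2 ^ i \<and> mahler_measure f > 1}"

definition skew_reciprocal_measures :: "nat \<Rightarrow> real set" where
  "skew_reciprocal_measures i =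
     {mahler_measure f |f. monic f \<and> skew_reciprocal_poly f \<and> degree f = 2 ^ i \<and> mahler_measure f > 1}"

lemma finite_reciprocal_measures_le: "finite (reciprocal_measures i \<inter> {..C})"
proof (rule finite_subset)
  show "reciprocal_measures i \<inter> {..C} \<subseteq> mahler_measure ` {f. degree f \<le> 2 ^ i \<and> mahler_measure f \<le> C}"
    by (auto simp: reciprocal_measures_def)
qed (intro finite_imageI finite_mahler_measure_le)

lemma mahler_measure_in_reciprocal_measures:
  assumes "monic f" "reciprocal_poly f" "mahler_measure f > 1" "degree f \<le> 2 ^ i"
  shows "mahler_measure f \<in> reciprocal_measures i"
proof -
  define l :: "int poly" where "l = [:1, 1:]"
  have l: "monic l" "degree l = 1" "l \<noteq> 0" "mahler_measure l = 1" "reflect_poly l = l"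
    using mahler_measure_linear[of 1] by (simp_all add: l_def reflect_poly_def)
  define g where "g = f * l ^ (2 ^ i - degree f)"
  have "reciprocal_poly g"
    using assms(2) by (simp add: reciprocal_poly_def g_def reflect_poly_mult reflect_poly_power l)
  moreover have "monic g" unfolding g_def by (intro monic_mult monic_power assms(1) l(1))
  moreover have "f \<noteq> 0" using assms(1) by auto
  then have "degree g = 2 ^ i" using assms(4) l by (simp add: g_def degree_mult_eq degree_power_eq)
  moreover have "mahler_measure g = mahler_measure f"
    using l by (simp add: g_def mahler_measure_mult mahler_measure_power)
  ultimately show ?thesis using assms(3) unfolding reciprocal_measures_def
    by (intro CollectI exI[of _ g]) auto
qed

lemma reciprocal_measures_imp_skew_reciprocal_measures:
  assumes "i \<ge> 1"
  shows "reciprocal_measures i \<subseteq> skew_reciprocal_measures (Suc i)"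
proof
  fix x assume "x \<in> reciprocal_measures i"
  then obtain g where g: "x = mahler_measure g" "monic g" "reciprocal_poly g" "degree g = 2 ^ i" "x > 1"
    by (auto simp: reciprocal_measures_def)
  have "skew_reciprocal_poly (g \<circ>\<^sub>p monom 1 2)"
    using g(3,4) assms by (intro skew_reciprocal_pcompose_square) auto
  moreover have "degree (g \<circ>\<^sub>p monom 1 2) = 2 ^ Suc i"
    by (simp add: degree_pcompose degree_monom_eq g(4))
  ultimately show "x \<in> skew_reciprocal_measures (Suc i)"
    using g mahler_measure_pcompose_monom[of 2 g] monic_pcompose_monom_iff[of 2 g]
    unfolding skew_reciprocal_measures_def by (intro CollectI exI[of _ "g \<circ>\<^sub>p monom 1 2"]) auto
qed

lemma small_skew_reciprocal_measures:
  assumes "i \<ge> 1" "x \<in> skew_reciprocal_measures (Suc i)" "x < nonreciprocal_bound"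
  shows "x \<in> reciprocal_measures i"
proof -
  obtain f where f: "x = mahler_measure f" "monic f" "skew_reciprocal_poly f" "degree f = 2 * 2 ^ i" "x > 1"
    using assms(2) by (auto simp: skew_reciprocal_measures_def)
  have "even (2 ^ i :: nat)" using assms(1) by simp
  then obtain g where "f = g \<circ>\<^sub>p monom 1 2" "monic g" "reciprocal_poly g" "degree g = 2 ^ i"
    using skew_reciprocal_eq_pcompose_square[OF f(2-4)] assms(3) f(1) by blast
  then show ?thesis
    using f mahler_measure_pcompose_monom[of 2 g] unfolding reciprocal_measures_def
    by (intro CollectI exI[of _ g]) auto
qed

lemma lehmer_number_in_reciprocal_measures:
  assumes "i \<ge> 4"
  shows "lehmer_number \<in> reciprocal_measures i"
proof -
  have "(2 :: nat) ^ 4 \<le> 2 ^ i" using assms by (intro power_increasing) auto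
  then show ?thesis
    using mahler_measure_in_reciprocal_measures[of lehmer_poly i] monic_lehmer_poly degree_lehmer_poly
      lehmer_number_bounds(1) reflect_lehmer_poly
    by (simp add: lehmer_number_def reciprocal_poly_def)
qed

lemma is_smallest_reciprocal_measure:
  assumes "i \<ge> 4"
  shows "is_smallest (smallest_reciprocal_measure i) (reciprocal_measures i)"
proof -
  have "\<exists>x. is_smallest x (reciprocal_measures i)"
    using lehmer_number_in_reciprocal_measures[OF assms] finite_reciprocal_measures_le
    by (rule is_smallest_exists)
  then show ?thesis
    unfolding smallest_reciprocal_measure_def reciprocal_measures_def[symmetric]
    by (metis is_smallest_unique theI)
qed

lemma smallest_reciprocal_measure_le:
  assumes "i \<ge> 4" "x \<in> reciprocal_measures i"
  shows "smallest_reciprocal_measure i \<le> x"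
  using is_smallest_reciprocal_measure[OF assms(1)] assms(2) by (simp add: is_smallest_def)

lemma smallest_reciprocal_measure_attained:
  assumes "i \<ge> 4"
  obtains f where "monic f" "degree f = 2 ^ i" "mahler_measure f = smallest_reciprocal_measure i"
    "smallest_reciprocal_measure i > 1"
  using is_smallest_reciprocal_measure[OF assms]
  by (auto simp: is_smallest_def reciprocal_measures_def)

lemma smallest_reciprocal_measure_le_lehmer_number:
  "i \<ge> 4 \<Longrightarrow> smallest_reciprocal_measure i \<le> lehmer_number"
  by (intro smallest_reciprocal_measure_le lehmer_number_in_reciprocal_measures)

lemma smallest_reciprocal_measure_4: "smallest_reciprocal_measure 4 = lehmer_number"
proof (rule antisym)
  obtain f where "monic f" "degree f = 2 ^ 4" "mahler_measure f = smallest_reciprocal_measure 4"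
      "smallest_reciprocal_measure 4 > 1"
    using smallest_reciprocal_measure_attained[of 4] by auto
  then show "lehmer_number \<le> smallest_reciprocal_measure 4"
    using mahler_measure_degree_le_16[of f] by simp
qed (simp add: smallest_reciprocal_measure_le_lehmer_number)

lemma smallest_skew_reciprocal_measure_Suc:
  assumes "i \<ge> 4"
  shows "smallest_skew_reciprocal_measure (Suc i) = smallest_reciprocal_measure i"
proof -
  define x where "x = smallest_reciprocal_measure i"
  have "x < nonreciprocal_bound"
    using smallest_reciprocal_measure_le_lehmer_number[OF assms] lehmer_number_less_nonreciprocal_bound
    by (simp add: x_def)
  have "is_smallest x (skew_reciprocal_measures (Suc i))"
    unfolding is_smallest_def
  proof (intro conjI ballI)
    show "x \<in> skew_reciprocal_measures (Suc i)"
      using is_smallest_reciprocal_measure[OF assms] reciprocal_measures_imp_skew_reciprocal_measures[of i] assms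
      by (auto simp: is_smallest_def x_def)
    fix y assume "y \<in> skew_reciprocal_measures (Suc i)"
    then show "x \<le> y"
      using small_skew_reciprocal_measures[of i y] smallest_reciprocal_measure_le[OF assms, of y]
        \<open>x < nonreciprocal_bound\<close> assms
      by (cases "y < nonreciprocal_bound") (auto simp: x_def)
  qed
  then show ?thesis
    unfolding smallest_skew_reciprocal_measure_def skew_reciprocal_measures_def[symmetric] x_def
    by (rule the_equality) (metis is_smallest_unique \<open>is_smallest x _\<close> x_def)
qed

lemma eventually_smallest_reciprocal_measure_le:
  assumes "monic f" "1 < mahler_measure f" "mahler_measure f < nonreciprocal_bound"
  shows "eventually (\<lambda>i. smallest_reciprocal_measure i \<le> mahler_measure f) sequentially"
proof -
  obtain g where g: "monic g" "reciprocal_poly g" "mahler_measure g = mahler_measure f"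
    using reciprocal_same_mahler_measure[OF assms(1,3)] .
  have "smallest_reciprocal_measure i \<le> mahler_measure f" if "i \<ge> max 4 (degree g)" for i
  proof -
    have "degree g \<le> 2 ^ i" using that less_exp[of i] by linarith
    then show ?thesis
      using that g assms(2) mahler_measure_in_reciprocal_measures[of g i] smallest_reciprocal_measure_le[of i]
      by simp
  qed
  then show ?thesis by (rule eventually_sequentiallyI)
qed

lemma lehmer_number_smallest_iff:
  "is_smallest lehmer_number {mahler_measure f |f. monic f \<and> mahler_measure f > 1}
     \<longleftrightarrow> (\<forall>i\<ge>4. smallest_reciprocal_measure i = lehmer_number)"
proof
  assume min: "is_smallest lehmer_number {mahler_measure f |f. monic f \<and> mahler_measure f > 1}"
  show "\<forall>i\<ge>4. smallest_reciprocal_measure i = lehmer_number"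
  proof (intro allI impI antisym)
    fix i :: nat
    assume i: "i \<ge> 4"
    then obtain f where "monic f" "mahler_measure f = smallest_reciprocal_measure i" "smallest_reciprocal_measure i > 1"
      by (rule smallest_reciprocal_measure_attained)
    then show "lehmer_number \<le> smallest_reciprocal_measure i"
      using min by (force simp: is_smallest_def)
  qed (rule smallest_reciprocal_measure_le_lehmer_number)
next
  assume const: "\<forall>i\<ge>4. smallest_reciprocal_measure i = lehmer_number"
  have "lehmer_number \<le> mahler_measure f" if f: "monic f" "mahler_measure f > 1" for f
  proof (rule ccontr)
    assume less: "\<not> lehmer_number \<le> mahler_measure f"
    then have "mahler_measure f < nonreciprocal_bound"
      using lehmer_number_less_nonreciprocal_bound by linarith
    then have "eventually (\<lambda>i. smallest_reciprocal_measure i \<le> mahler_measure f \<and> i \<ge> 4) sequentially"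
      using f
      by (intro eventually_conj eventually_smallest_reciprocal_measure_le eventually_ge_at_top)
    then show False using const less by (auto dest: eventually_happens)
  qed
  moreover have "lehmer_number \<in> {mahler_measure f |f. monic f \<and> mahler_measure f > 1}"
    using monic_lehmer_poly lehmer_number_bounds(1) unfolding lehmer_number_def by blast
  ultimately show "is_smallest lehmer_number {mahler_measure f |f. monic f \<and> mahler_measure f > 1}"
    unfolding is_smallest_def by blast
qed

lemma islimpt_if_smallest_reciprocal_measure_tendsto_1:
  assumes "smallest_reciprocal_measure \<longlonglongrightarrow> 1"
  shows "1 islimpt {mahler_measure f |f. monic f}"
  unfolding islimpt_approachable
proof (intro allI impI)
  fix e :: real
  assume "e > 0"
  then have "eventually (\<lambda>i. dist (smallest_reciprocal_measure i) 1 < e \<and> i \<ge> 4) sequentially"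
    using assms by (intro eventually_conj tendstoD eventually_ge_at_top)
  then obtain i where i: "dist (smallest_reciprocal_measure i) 1 < e" "i \<ge> 4"
    by (auto dest: eventually_happens)
  obtain f where "monic f" "mahler_measure f = smallest_reciprocal_measure i" "smallest_reciprocal_measure i > 1"
    using i(2) by (rule smallest_reciprocal_measure_attained)
  then show "\<exists>x\<in>{mahler_measure f |f. monic f}. x \<noteq> 1 \<and> dist x 1 < e"
    using i(1) by (intro bexI[of _ "mahler_measure f"]) (simp, blast)
qed

lemma smallest_reciprocal_measure_tendsto_1_if_islimpt:
  assumes "1 islimpt {mahler_measure f |f. monic f}"
  shows "smallest_reciprocal_measure \<longlonglongrightarrow> 1"
proof (rule tendstoI)
  fix e :: real
  assume "e > 0"
  then have "min e (nonreciprocal_bound - 1) > 0"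
    using lehmer_number_bounds(1) lehmer_number_less_nonreciprocal_bound by simp
  then obtain f where f: "monic f" "mahler_measure f \<noteq> 1"
      "dist (mahler_measure f) 1 < min e (nonreciprocal_bound - 1)"
    using assms unfolding islimpt_approachable by blast
  have "f \<noteq> 0" using f(1) by auto
  then have "mahler_measure f > 1" using mahler_measure_poly_ge_1[of f] f(2) by simp
  then have "eventually (\<lambda>i. smallest_reciprocal_measure i \<le> mahler_measure f \<and> i \<ge> 4) sequentially"
    using f
    by (intro eventually_conj eventually_smallest_reciprocal_measure_le eventually_ge_at_top)
      (auto simp: dist_real_def)
  then show "eventually (\<lambda>i. dist (smallest_reciprocal_measure i) 1 < e) sequentially"
  proof (rule eventually_mono)
    fix i
    assume i: "smallest_reciprocal_measure i \<le> mahler_measure f \<and> i \<ge> 4"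
    then have "smallest_reciprocal_measure i > 1"
      using smallest_reciprocal_measure_attained by blast
    then show "dist (smallest_reciprocal_measure i) 1 < e" using i f(3) by (simp add: dist_real_def)
  qed
qed

lemma prod_smallest_measures:
  assumes "N \<ge> 4"
  shows "(\<Prod>i=5..N. smallest_reciprocal_measure i / smallest_skew_reciprocal_measure i)
    = smallest_reciprocal_measure N / lehmer_number"
  using assms
proof (induction N rule: dec_induct)
  case base
  then show ?case using lehmer_number_bounds(1) by (simp add: smallest_reciprocal_measure_4)
next
  case (step n)
  have "smallest_reciprocal_measure n > 1"
    using smallest_reciprocal_measure_attained step.hyps(1) by blast
  then show ?case
    using step by (simp add: smallest_skew_reciprocal_measure_Suc)
qed

lemma smallest_measures_eq_iff:
  "(\<forall>i\<ge>5. smallest_reciprocal_measure i = smallest_skew_reciprocal_measure i)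
     \<longleftrightarrow> (\<forall>i\<ge>4. smallest_reciprocal_measure i = lehmer_number)"
proof
  assume eq: "\<forall>i\<ge>5. smallest_reciprocal_measure i = smallest_skew_reciprocal_measure i"
  have "smallest_reciprocal_measure i = lehmer_number" if "i \<ge> 4" for i
    using that
  proof (induction i rule: dec_induct)
    case (step n)
    then show ?case using eq smallest_skew_reciprocal_measure_Suc[of n] by simp
  qed (rule smallest_reciprocal_measure_4)
  then show "\<forall>i\<ge>4. smallest_reciprocal_measure i = lehmer_number" by blast
next
  assume const: "\<forall>i\<ge>4. smallest_reciprocal_measure i = lehmer_number"
  show "\<forall>i\<ge>5. smallest_reciprocal_measure i = smallest_skew_reciprocal_measure i"
  proof (intro allI impI)
    fix i :: nat
    assume "i \<ge> 5"
    then obtain j where "i = Suc j" "j \<ge> 4" by (cases i) auto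
    then show "smallest_reciprocal_measure i = smallest_skew_reciprocal_measure i"
      using const smallest_skew_reciprocal_measure_Suc[of j] by simp
  qed
qed

theorem theorem1:
  shows "(is_smallest lehmer_number {mahler_measure f |f. monic f \<and> mahler_measure f > 1}
            \<longleftrightarrow> (\<forall>i\<ge>5. smallest_reciprocal_measure i = smallest_skew_reciprocal_measure i))
       \<and> (1 islimpt {mahler_measure f |f. monic f}
            \<longleftrightarrow> (\<lambda>N. \<Prod>i=5..N. smallest_reciprocal_measure i / smallest_skew_reciprocal_measure i)
                  \<longlonglongrightarrow> inverse lehmer_number)"
proof (intro conjI)
  show "is_smallest lehmer_number {mahler_measure f |f. monic f \<and> mahler_measure f > 1}
      \<longleftrightarrow> (\<forall>i\<ge>5. smallest_reciprocal_measure i = smallest_skew_reciprocal_measure i)"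
    unfolding lehmer_number_smallest_iff smallest_measures_eq_iff ..
  have "(\<lambda>N. \<Prod>i=5..N. smallest_reciprocal_measure i / smallest_skew_reciprocal_measure i)
        \<longlonglongrightarrow> inverse lehmer_number
      \<longleftrightarrow> (\<lambda>N. smallest_reciprocal_measure N / lehmer_number) \<longlonglongrightarrow> inverse lehmer_number"
    by (intro filterlim_cong refl eventually_sequentiallyI[of 4])
      (simp only: prod_smallest_measures)
  also have "\<dots> \<longleftrightarrow> smallest_reciprocal_measure \<longlonglongrightarrow> 1"
    using lehmer_number_bounds(1) tendsto_mult_right_iff[of "inverse lehmer_number" smallest_reciprocal_measure 1]
    by (simp add: divide_inverse)
  finally show "1 islimpt {mahler_measure f |f. monic f}
      \<longleftrightarrow> (\<lambda>N. \<Prod>i=5..N. smallest_reciprocal_measure i / smallest_skew_reciprocal_measure i)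
            \<longlonglongrightarrow> inverse lehmer_number"
    using islimpt_if_smallest_reciprocal_measure_tendsto_1 smallest_reciprocal_measure_tendsto_1_if_islimpt by blast
qed

end
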